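(* Let $P$ be an $m\times m$ pattern and $Q$ an $n\times n$ pattern, each of full term-rank, such that the bigraphs $\mathcal{B}(P)$ and $\mathcal{B}(Q)$ are connected. Let $E$ be an $m\times n$ pattern and $F$ an $n\times m$ pattern such that the total number of nonzero entries in $E$ and $F$ together is at least $2$. Then there is a real matrix with pattern \[ M=\begin{bmatrix} P & E\\ F & Q\end{bmatrix}\] that has the SSVP and a multiple singular value.
   Context: A pattern is a matrix with all entries in $\{0,1\}$; a real matrix has pattern $P$ if its $(i,j)$ entry is nonzero exactly when $p_{ij}=1$. The singular values of a real $m\times n$ matrix $A$ are the nonnegative square roots of the $m$ eigenvalues of $AA^T$, taken as a multiset; a multiple singular value is one occurring with multiplicity at least $2$ in this multiset. A real $m\times n$ matrix $A$ has the Strong Singular Value Property (SSVP) if the zero matrix is the only $m\times n$ matrix $X$ such that $A^TX$ is symmetric, $XA^T$ is symmetric, and $A\circ X=O$ ($\circ$ the entrywise product). The term-rank of a matrix is the largest number of nonzero entries with no two in the same row or column; an $m\times m$ pattern has full term-rank if its term-rank is $m$. The bigraph $\mathcal{B}(P)$ of an $m\times n$ pattern $P$ is the bipartite graph with row vertices $1,\dots,m$, column vertices $1',\dots,n'$, and an edge $i$---$j'$ iff $p_{ij}=1$. *)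

theory Defs
  imports "Jordan_Normal_Form.Char_Poly" "Graph_Theory.Graph_Theory"
begin

text \<open>Matrix positions are indexed from 0, as usual for the type \<open>mat\<close>.\<close>

definition is_pattern :: "nat mat \<Rightarrow> bool" where
  "is_pattern P \<longleftrightarrow> elements_mat P \<subseteq> {0, 1}"

definition has_pattern :: "real mat \<Rightarrow> nat mat \<Rightarrow> bool" where
  "has_pattern A P \<longleftrightarrow> dim_row A = dim_row P \<and> dim_col A = dim_col P \<and>
     (\<forall>i < dim_row P. \<forall>j < dim_col P. A $$ (i, j) \<noteq> 0 \<longleftrightarrow> P $$ (i, j) = 1)"

definition nonzero_positions :: "'a :: zero mat \<Rightarrow> (nat \<times> nat) set" where
  "nonzero_positions A = {(i, j). i < dim_row A \<and> j < dim_col A \<and> A $$ (i, j) \<noteq> 0}"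

text \<open>
  Injectivity of the two projections on \<open>S\<close> says that no two positions in \<open>S\<close> share a row
  or a column.
\<close>

definition term_rank :: "'a :: zero mat \<Rightarrow> nat" where
  "term_rank A = Max {card S | S. S \<subseteq> nonzero_positions A \<and> inj_on fst S \<and> inj_on snd S}"

text \<open>
  The bigraph as a graph on tagged indices: \<open>Inl i\<close> is the row vertex \<open>i\<close> and \<open>Inr j\<close> the
  column vertex \<open>j'\<close>. Each edge is a single arc from its row to its column vertex;
  \<^const>\<open>Digraph_Component.connected\<close> passes to the underlying undirected graph (and is false
  for the graph without vertices).
\<close>

definition bigraph :: "nat mat \<Rightarrow> (nat + nat) pair_pre_digraph" where
  "bigraph P = \<lparr> pverts = Inl ` {..<dim_row P} \<union> Inr ` {..<dim_col P},
     parcs = {(Inl i, Inr j) | i j. i < dim_row P \<and> j < dim_col P \<and> P $$ (i, j) = 1} \<rparr>"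

abbreviation bigraph_connected :: "nat mat \<Rightarrow> bool" where
  "bigraph_connected P \<equiv> Digraph_Component.connected (with_proj (bigraph P))"

text \<open>
  The multiset of roots of the characteristic polynomial lists the eigenvalues with their
  algebraic multiplicities. As \<open>A * A\<^sup>T\<close> is real symmetric and positive semidefinite, all
  its eigenvalues are real and nonnegative, so no root is lost by working over the reals.
\<close>

definition singular_values :: "real mat \<Rightarrow> real multiset" where
  "singular_values A = image_mset sqrt (proots (char_poly (A * transpose_mat A)))"

definition has_multiple_singular_value :: "real mat \<Rightarrow> bool" where
  "has_multiple_singular_value A \<longleftrightarrow> (\<exists>\<sigma>. count (singular_values A) \<sigma> \<ge> 2)"

definition symmetric_mat :: "'a mat \<Rightarrow> bool" where
  "symmetric_mat A \<longleftrightarrow> transpose_mat A = A"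

definition entrywise_prod :: "'a :: times mat \<Rightarrow> 'a mat \<Rightarrow> 'a mat" where
  "entrywise_prod A B = mat (dim_row A) (dim_col A) (\<lambda>ij. A $$ ij * B $$ ij)"

definition SSVP :: "real mat \<Rightarrow> bool" where
  "SSVP A \<longleftrightarrow> (\<forall>X \<in> carrier_mat (dim_row A) (dim_col A).
     symmetric_mat (transpose_mat A * X) \<and> symmetric_mat (X * transpose_mat A) \<and>
     entrywise_prod A X = 0\<^sub>m (dim_row A) (dim_col A) \<longrightarrow>
     X = 0\<^sub>m (dim_row A) (dim_col A))"

end

theory Submission
  imports Defs
begin

text \<open>
  Choose nonnegative matrices \<open>A\<close> and \<open>B\<close> with patterns \<open>P\<close> and \<open>Q\<close> that are close to
  weighted permutation matrices, scaled to have largest singular value 1 and with no other common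
  singular value. By connectivity the Perron vectors \<open>u\<^sub>1, v\<^sub>1\<close> of \<open>A\<close> and \<open>u\<^sub>2, v\<^sub>2\<close> of \<open>B\<close>
  have no zero entry. The matrices \<open>X\<close> which witness that the direct sum of \<open>A\<close> and \<open>B\<close> fails the
  SSVP are the multiples of the off-diagonal matrix with blocks \<open>u\<^sub>1 v\<^sub>2\<^sup>T\<close> and \<open>u\<^sub>2 v\<^sub>1\<^sup>T\<close>.
  Hence one position of \<open>E\<close> or \<open>F\<close> already excludes them, and, since having only the trivial
  solution is an open condition, every small perturbation with pattern \<open>M\<close> has the SSVP.

  To keep a multiple singular value, fix small positive values at all positions of \<open>E\<close> and \<open>F\<close>
  but one, and minimize the largest singular value of the perturbed matrix over the remaining
  entry \<open>x\<close> and over the scalings \<open>(1 + s) A\<close>, \<open>(1 - s) B\<close>. Were the largest singular value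
  simple at the minimizer, its derivatives in \<open>s\<close> and \<open>x\<close> would vanish there, which is impossible
  close to the direct sum. By Perron-Frobenius the minimizer has \<open>x \<noteq> 0\<close>; this is where a second
  position of \<open>E\<close> or \<open>F\<close> is needed.
\<close>

subsection \<open>Largest eigenvalues of symmetric matrices\<close>

text \<open>Bolzano-Weierstrass, one coordinate at a time: a further subsequence, monotone at the
  new coordinate, keeps the earlier limits. Points are functions on an index set, so that vectors,
  matrices and parameter pairs are treated alike.\<close>

lemma pointwise_convergent_subseq:
  fixes x :: "nat \<Rightarrow> 'a \<Rightarrow> real"
  assumes "finite V" and "\<And>k a. a \<in> V \<Longrightarrow> \<bar>x k a\<bar> \<le> C"
  obtains r l where "strict_mono (r :: nat \<Rightarrow> nat)" and "\<And>a. a \<in> V \<Longrightarrow> (\<lambda>k. x (r k) a) \<longlonglongrightarrow> l a"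
proof -
  have "\<exists>r l. strict_mono (r :: nat \<Rightarrow> nat) \<and> (\<forall>a\<in>V. (\<lambda>k. x (r k) a) \<longlonglongrightarrow> l a)"
    using assms
  proof (induction V rule: finite_induct)
    case empty
    show ?case by (intro exI[of _ id]) (auto simp: strict_mono_def)
  next
    case (insert v V)
    then obtain r l where r: "strict_mono (r :: nat \<Rightarrow> nat)"
      and l: "\<forall>a\<in>V. (\<lambda>k. x (r k) a) \<longlonglongrightarrow> l a" by auto
    obtain g where g: "strict_mono (g :: nat \<Rightarrow> nat)" and mg: "monoseq (\<lambda>n. x (r (g n)) v)"
      using seq_monosub[of "\<lambda>n. x (r n) v"] by auto
    have "Bseq (\<lambda>n. x (r (g n)) v)"
      using insert.prems by (intro BseqI'[of _ C]) auto
    with mg have "convergent (\<lambda>n. x (r (g n)) v)"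
      by (rule Bseq_monoseq_convergent[rotated])
    then obtain c where c: "(\<lambda>n. x (r (g n)) v) \<longlonglongrightarrow> c"
      by (auto simp: convergent_def)
    have "(\<lambda>k. x ((r \<circ> g) k) a) \<longlonglongrightarrow> (l(v := c)) a" if "a \<in> insert v V" for a
      using that c LIMSEQ_subseq_LIMSEQ[OF _ g, of "\<lambda>k. x (r k) a" "l a"] l
      by (cases "a = v") (auto simp: o_def)
    moreover have "strict_mono (r \<circ> g)" using r g by (rule strict_mono_o)
    ultimately show ?case by blast
  qed
  then show ?thesis using that by blast
qed

text \<open>A minimizing sequence has a subsequence that converges on \<open>V\<close>, and its
  limit is a minimizer. Since limits are controlled on \<open>V\<close> only, \<open>closed\<close>
  and \<open>cont\<close> speak of every \<open>l\<close> that agrees there with the limit.\<close>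

lemma attains_inf_seq:
  fixes f :: "('a \<Rightarrow> real) \<Rightarrow> real"
  assumes "finite V" and "S \<noteq> {}" and bdd: "bdd_below (f ` S)"
    and bounded: "\<And>y a. y \<in> S \<Longrightarrow> a \<in> V \<Longrightarrow> \<bar>y a\<bar> \<le> C"
    and closed: "\<And>x l. (\<And>k. x k \<in> S) \<Longrightarrow> (\<And>a. a \<in> V \<Longrightarrow> (\<lambda>k. x k a) \<longlonglongrightarrow> l a) \<Longrightarrow> l \<in> S"
    and cont: "\<And>x l. (\<And>k. x k \<in> S) \<Longrightarrow> (\<And>a. a \<in> V \<Longrightarrow> (\<lambda>k. x k a) \<longlonglongrightarrow> l a) \<Longrightarrow>
      (\<lambda>k. f (x k)) \<longlonglongrightarrow> f l"
  obtains w where "w \<in> S" and "\<And>y. y \<in> S \<Longrightarrow> f w \<le> f y"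
proof -
  have "\<exists>y\<in>S. f y < Inf (f ` S) + 1 / real (Suc k)" for k
    using cInf_lessD[of "f ` S" "Inf (f ` S) + 1 / real (Suc k)"] \<open>S \<noteq> {}\<close> by auto
  then obtain y where yS: "\<And>k. y k \<in> S" and y: "\<And>k. f (y k) < Inf (f ` S) + 1 / real (Suc k)"
    by metis
  obtain r l where r: "strict_mono (r :: nat \<Rightarrow> nat)" and l: "\<And>a. a \<in> V \<Longrightarrow> (\<lambda>k. y (r k) a) \<longlonglongrightarrow> l a"
    using pointwise_convergent_subseq[OF \<open>finite V\<close>, of y C] bounded yS by metis
  have lS: "l \<in> S" using closed[of "\<lambda>k. y (r k)"] yS l by auto
  have lim: "(\<lambda>k. f (y (r k))) \<longlonglongrightarrow> f l" using cont[of "\<lambda>k. y (r k)"] yS l by auto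
  have "(\<lambda>k. Inf (f ` S) + 1 / real (Suc k)) \<longlonglongrightarrow> Inf (f ` S) + 0"
    by (intro tendsto_intros LIMSEQ_Suc lim_1_over_n)
  then have "(\<lambda>k. Inf (f ` S) + 1 / real (Suc (r k))) \<longlonglongrightarrow> Inf (f ` S)"
    using LIMSEQ_subseq_LIMSEQ[OF _ r] by (fastforce simp: o_def)
  from LIMSEQ_le[OF lim this] have "f l \<le> Inf (f ` S)"
    using y by (meson less_imp_le)
  then have "f l \<le> f z" if "z \<in> S" for z
    using cInf_lower[OF _ bdd, of "f z"] that by auto
  with lS that show ?thesis by blast
qed

section \<open>Quadratic forms and their maximum on the unit sphere\<close>

definition quad :: "'a set \<Rightarrow> ('a \<Rightarrow> 'a \<Rightarrow> real) \<Rightarrow> ('a \<Rightarrow> real) \<Rightarrow> real" where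
  "quad V H y = (\<Sum>a\<in>V. \<Sum>b\<in>V. H a b * y a * y b)"

definition sqnorm :: "'a set \<Rightarrow> ('a \<Rightarrow> real) \<Rightarrow> real" where
  "sqnorm V y = (\<Sum>a\<in>V. (y a)\<^sup>2)"

definition eigvec :: "'a set \<Rightarrow> ('a \<Rightarrow> 'a \<Rightarrow> real) \<Rightarrow> real \<Rightarrow> ('a \<Rightarrow> real) \<Rightarrow> bool" where
  "eigvec V H c w \<longleftrightarrow> (\<forall>a\<in>V. (\<Sum>b\<in>V. H a b * w b) = c * w a)"

text \<open>The largest eigenvalue, when \<open>V\<close> is finite and nonempty and \<open>H\<close> is symmetric on \<open>V\<close>.\<close>

definition maxev :: "'a set \<Rightarrow> ('a \<Rightarrow> 'a \<Rightarrow> real) \<Rightarrow> real" where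
  "maxev V H = Sup (quad V H ` {y. sqnorm V y = 1})"

lemma sqnorm_nonneg: "0 \<le> sqnorm V y"
  by (simp add: sqnorm_def sum_nonneg)

lemma sqnorm_eq_0_iff: "finite V \<Longrightarrow> sqnorm V y = 0 \<longleftrightarrow> (\<forall>a\<in>V. y a = 0)"
  by (simp add: sqnorm_def sum_nonneg_eq_0_iff)

lemma sqnorm_scale: "sqnorm V (\<lambda>a. c * y a) = c\<^sup>2 * sqnorm V y"
  by (simp add: sqnorm_def power_mult_distrib sum_distrib_left)

lemma quad_scale: "quad V H (\<lambda>a. c * y a) = c\<^sup>2 * quad V H y"
  by (simp add: quad_def sum_distrib_left power2_eq_square mult_ac)

lemma abs_le_1_if_sqnorm_1:
  assumes "finite V" "sqnorm V y = 1" "a \<in> V"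
  shows "\<bar>y a\<bar> \<le> 1"
proof -
  have "(y a)\<^sup>2 \<le> sqnorm V y"
    unfolding sqnorm_def using assms by (intro member_le_sum) auto
  then show ?thesis using assms by (simp add: abs_square_le_1)
qed

lemma quad_tendsto:
  assumes "\<And>a b. a \<in> V \<Longrightarrow> b \<in> V \<Longrightarrow> (\<lambda>k. H k a b) \<longlonglongrightarrow> H' a b"
    and "\<And>a. a \<in> V \<Longrightarrow> (\<lambda>k. y k a) \<longlonglongrightarrow> l a"
  shows "(\<lambda>k. quad V (H k) (y k)) \<longlonglongrightarrow> quad V H' l"
  unfolding quad_def using assms by (intro tendsto_intros) auto

lemma sqnorm_tendsto:
  assumes "\<And>a. a \<in> V \<Longrightarrow> (\<lambda>k. y k a) \<longlonglongrightarrow> l a"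
  shows "(\<lambda>k. sqnorm V (y k)) \<longlonglongrightarrow> sqnorm V l"
  unfolding sqnorm_def using assms by (intro tendsto_intros) auto

lemma sqnorm_1_limit:
  assumes "\<And>k. sqnorm V (y k) = 1" and "\<And>a. a \<in> V \<Longrightarrow> (\<lambda>k. y k a) \<longlonglongrightarrow> l a"
  shows "sqnorm V l = 1"
  using LIMSEQ_unique[OF sqnorm_tendsto[of V y l]] assms by (auto simp: LIMSEQ_const_iff)

lemma normalize_sqnorm:
  assumes "finite V" "a \<in> V" "y a \<noteq> 0"
  obtains c where "c > 0" and "sqnorm V (\<lambda>a. c * y a) = 1"
proof -
  have "sqnorm V y \<noteq> 0" using assms by (auto simp: sqnorm_eq_0_iff)
  then have "sqnorm V y > 0" using sqnorm_nonneg[of V y] by linarith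
  then have "sqnorm V (\<lambda>a. (1 / sqrt (sqnorm V y)) * y a) = 1"
    by (subst sqnorm_scale) (simp add: power_divide)
  then show ?thesis using that \<open>sqnorm V y > 0\<close> by (metis real_sqrt_gt_0_iff zero_less_divide_1_iff)
qed

text \<open>The unit sphere is compact and the form continuous, so the supremum is attained;
  homogeneity carries the bound to every \<open>y\<close>.\<close>

lemma ex_maximizer:
  assumes "finite V" "V \<noteq> {}"
  obtains w where "sqnorm V w = 1" and "quad V H w = maxev V H"
    and "\<And>y. quad V H y \<le> maxev V H * sqnorm V y"
proof -
  let ?S = "{y. sqnorm V y = 1}"
  obtain v where "v \<in> V" using assms by auto
  obtain c where "sqnorm V (\<lambda>a. c * 1) = 1"
    using normalize_sqnorm[OF \<open>finite V\<close> \<open>v \<in> V\<close>, of "\<lambda>_. 1"] by auto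
  then have ne: "?S \<noteq> {}" by auto
  have bound: "\<bar>quad V H y\<bar> \<le> (\<Sum>a\<in>V. \<Sum>b\<in>V. \<bar>H a b\<bar>)" if "y \<in> ?S" for y
  proof -
    have "\<bar>quad V H y\<bar> \<le> (\<Sum>a\<in>V. \<Sum>b\<in>V. \<bar>H a b * y a * y b\<bar>)"
      unfolding quad_def by (rule order_trans[OF sum_abs]) (intro sum_mono sum_abs)
    also have "\<dots> \<le> (\<Sum>a\<in>V. \<Sum>b\<in>V. \<bar>H a b\<bar>)"
    proof (intro sum_mono)
      fix a b assume "a \<in> V" "b \<in> V"
      then have "\<bar>y a\<bar> * \<bar>y b\<bar> \<le> 1"
        using that abs_le_1_if_sqnorm_1[OF \<open>finite V\<close>] by (intro mult_le_one) auto
      then show "\<bar>H a b * y a * y b\<bar> \<le> \<bar>H a b\<bar>"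
        using mult_left_mono[of "\<bar>y a\<bar> * \<bar>y b\<bar>" 1 "\<bar>H a b\<bar>"] by (simp add: abs_mult mult_ac)
    qed
    finally show ?thesis .
  qed
  have "\<exists>w\<in>?S. \<forall>y\<in>?S. - quad V H w \<le> - quad V H y"
  proof (rule attains_inf_seq[OF \<open>finite V\<close> ne, of "\<lambda>y. - quad V H y" 1])
    show "bdd_below ((\<lambda>y. - quad V H y) ` ?S)"
      using bound by (intro bdd_belowI[of _ "- (\<Sum>a\<in>V. \<Sum>b\<in>V. \<bar>H a b\<bar>)"]) (auto simp: abs_le_iff)
    show "\<And>y a. y \<in> ?S \<Longrightarrow> a \<in> V \<Longrightarrow> \<bar>y a\<bar> \<le> 1"
      using abs_le_1_if_sqnorm_1[OF \<open>finite V\<close>] by auto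
    show "l \<in> ?S" if "\<And>k. x k \<in> ?S" "\<And>a. a \<in> V \<Longrightarrow> (\<lambda>k. x k a) \<longlonglongrightarrow> l a" for x l
      using sqnorm_1_limit[of V x l] that by auto
    show "(\<lambda>k. - quad V H (x k)) \<longlonglongrightarrow> - quad V H l"
      if "\<And>k. x k \<in> ?S" "\<And>a. a \<in> V \<Longrightarrow> (\<lambda>k. x k a) \<longlonglongrightarrow> l a" for x l
      using that by (intro tendsto_minus quad_tendsto) auto
  qed blast
  then obtain w where w: "w \<in> ?S" and wmin: "\<And>y. y \<in> ?S \<Longrightarrow> - quad V H w \<le> - quad V H y"
    by blast
  have m: "maxev V H = quad V H w"
    unfolding maxev_def using w wmin by (intro cSup_eq_maximum) auto
  have "quad V H y \<le> maxev V H * sqnorm V y" for y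
  proof (cases "\<forall>a\<in>V. y a = 0")
    case True
    then show ?thesis by (simp add: quad_def sqnorm_def)
  next
    case False
    then obtain c where c: "c > 0" "sqnorm V (\<lambda>a. c * y a) = 1"
      using normalize_sqnorm[OF \<open>finite V\<close>, of _ y] by metis
    then have "c\<^sup>2 * quad V H y \<le> maxev V H * (c\<^sup>2 * sqnorm V y)"
      using wmin[of "\<lambda>a. c * y a"] by (simp add: m quad_scale sqnorm_scale)
    then have "c\<^sup>2 * quad V H y \<le> c\<^sup>2 * (maxev V H * sqnorm V y)" by (simp add: mult_ac)
    then show ?thesis using c by simp
  qed
  then show ?thesis using that w m by auto
qed

lemma quad_le_maxev:
  "finite V \<Longrightarrow> V \<noteq> {} \<Longrightarrow> quad V H y \<le> maxev V H * sqnorm V y"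
  using ex_maximizer by metis

lemma quad_diff_le:
  assumes "finite V" "sqnorm V y = 1"
  shows "quad V H y \<le> quad V H' y + (\<Sum>a\<in>V. \<Sum>b\<in>V. \<bar>H a b - H' a b\<bar>)"
proof -
  have "quad V H y - quad V H' y = (\<Sum>a\<in>V. \<Sum>b\<in>V. (H a b - H' a b) * y a * y b)"
    by (simp add: quad_def sum_subtractf left_diff_distrib)
  also have "\<dots> \<le> (\<Sum>a\<in>V. \<Sum>b\<in>V. \<bar>H a b - H' a b\<bar>)"
  proof (intro sum_mono)
    fix a b assume "a \<in> V" "b \<in> V"
    then have "\<bar>y a\<bar> * \<bar>y b\<bar> \<le> 1"
      using assms abs_le_1_if_sqnorm_1[OF \<open>finite V\<close>] by (intro mult_le_one) auto
    then have "\<bar>(H a b - H' a b) * y a * y b\<bar> \<le> \<bar>H a b - H' a b\<bar>"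
      using mult_left_mono[of "\<bar>y a\<bar> * \<bar>y b\<bar>" 1 "\<bar>H a b - H' a b\<bar>"] by (simp add: abs_mult mult_ac)
    then show "(H a b - H' a b) * y a * y b \<le> \<bar>H a b - H' a b\<bar>" by linarith
  qed
  finally show ?thesis by simp
qed

text \<open>A maximizer for \<open>H\<close> is a test vector for \<open>H'\<close>, and on the unit
  sphere the two forms differ by at most the sum of the entrywise differences. Hence
  \<open>maxev\<close> is Lipschitz in the entries.\<close>

lemma maxev_le_add:
  assumes "finite V" "V \<noteq> {}"
  shows "maxev V H \<le> maxev V H' + (\<Sum>a\<in>V. \<Sum>b\<in>V. \<bar>H a b - H' a b\<bar>)"
proof -
  obtain w where "sqnorm V w = 1" "quad V H w = maxev V H"
    using ex_maximizer[OF assms] by metis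
  then show ?thesis
    using quad_diff_le[OF assms(1), of w H H'] quad_le_maxev[OF assms, of H' w] by simp
qed

lemma maxev_tendsto:
  assumes "finite V" "V \<noteq> {}"
    and "\<And>a b. a \<in> V \<Longrightarrow> b \<in> V \<Longrightarrow> (\<lambda>k. H k a b) \<longlonglongrightarrow> H' a b"
  shows "(\<lambda>k. maxev V (H k)) \<longlonglongrightarrow> maxev V H'"
proof -
  have "(\<lambda>k. \<Sum>a\<in>V. \<Sum>b\<in>V. \<bar>H k a b - H' a b\<bar>) \<longlonglongrightarrow> (\<Sum>a\<in>V. \<Sum>b\<in>V. \<bar>H' a b - H' a b\<bar>)"
    using assms(3) by (intro tendsto_intros) auto
  then have *: "(\<lambda>k. \<Sum>a\<in>V. \<Sum>b\<in>V. \<bar>H k a b - H' a b\<bar>) \<longlonglongrightarrow> 0" by simp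
  have bound: "\<bar>maxev V (H k) - maxev V H'\<bar> \<le> (\<Sum>a\<in>V. \<Sum>b\<in>V. \<bar>H k a b - H' a b\<bar>)" for k
    using maxev_le_add[OF assms(1,2), of "H k" H'] maxev_le_add[OF assms(1,2), of H' "H k"]
    by (simp add: abs_le_iff abs_minus_commute[of "H' _ _"])
  have "(\<lambda>k. maxev V (H k) - maxev V H') \<longlonglongrightarrow> 0"
    by (intro tendsto_0_le[OF *, of _ 1] always_eventually allI)
      (use order_trans[OF bound abs_ge_self] in auto)
  then show ?thesis by (simp add: LIM_zero_iff)
qed

lemma quad_eigvec: "eigvec V H c w \<Longrightarrow> quad V H w = c * sqnorm V w"
proof -
  assume e: "eigvec V H c w"
  have "quad V H w = (\<Sum>a\<in>V. w a * (\<Sum>b\<in>V. H a b * w b))"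
    by (simp add: quad_def sum_distrib_left mult_ac)
  also have "\<dots> = (\<Sum>a\<in>V. w a * (c * w a))" using e by (simp add: eigvec_def)
  finally show ?thesis by (simp add: sqnorm_def sum_distrib_left power2_eq_square mult_ac)
qed

text \<open>Moving \<open>w\<close> by \<open>t\<close> in the single coordinate \<open>v\<close>
  turns the slack \<open>c * sqnorm V y - quad V H y\<close> into
  \<open>2 * t * g + t\<^sup>2 * D\<close>. As this is nonnegative for all \<open>t\<close>,
  \<open>g = 0\<close>, which is the eigenvector equation at \<open>v\<close>.\<close>

lemma maximizer_eigvec:
  assumes fin: "finite V" and sym: "\<And>a b. a \<in> V \<Longrightarrow> b \<in> V \<Longrightarrow> H a b = H b a"
    and max: "\<And>y. quad V H y \<le> c * sqnorm V y" and eq: "quad V H w = c * sqnorm V w"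
  shows "eigvec V H c w"
  unfolding eigvec_def
proof
  fix v assume v: "v \<in> V"
  define g where "g = c * w v - (\<Sum>b\<in>V. H v b * w b)"
  define D where "D = c - H v v"
  have expand: "c * sqnorm V (\<lambda>a. w a + t * (if a = v then 1 else 0)) - quad V H (\<lambda>a. w a + t * (if a = v then 1 else 0))
      = 2 * t * g + t\<^sup>2 * D" for t
  proof -
    have 1: "sqnorm V (\<lambda>a. w a + t * (if a = v then 1 else 0)) = sqnorm V w + 2 * t * w v + t\<^sup>2"
    proof -
      have "sqnorm V (\<lambda>a. w a + t * (if a = v then 1 else 0)) =
        (\<Sum>a\<in>V. (w a)\<^sup>2 + (if a = v then 2 * t * w v + t\<^sup>2 else 0))"
        unfolding sqnorm_def by (intro sum.cong) (auto simp: power2_eq_square algebra_simps)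
      then show ?thesis using fin v by (simp add: sum.distrib sqnorm_def)
    qed
    have "quad V H (\<lambda>a. w a + t * (if a = v then 1 else 0)) =
      (\<Sum>a\<in>V. \<Sum>b\<in>V. H a b * w a * w b + (if b = v then t * (H a v * w a) else 0)
        + (if a = v then t * (H v b * w b) + (if b = v then t\<^sup>2 * H v v else 0) else 0))"
      unfolding quad_def by (intro sum.cong) (auto simp: power2_eq_square algebra_simps)
    also have "\<dots> = quad V H w + (\<Sum>a\<in>V. t * (H a v * w a)) +
       (\<Sum>a\<in>V. if a = v then (\<Sum>b\<in>V. t * (H v b * w b) + (if b = v then t\<^sup>2 * H v v else 0)) else 0)"
    proof -
      have "(\<Sum>b\<in>V. if a = v then t * (H v b * w b) + (if b = v then t\<^sup>2 * H v v else 0) else 0)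
        = (if a = v then (\<Sum>b\<in>V. t * (H v b * w b) + (if b = v then t\<^sup>2 * H v v else 0)) else 0)" for a
        by simp
      then show ?thesis using fin v by (simp add: sum.distrib quad_def)
    qed
    also have "\<dots> = quad V H w + 2 * t * (\<Sum>b\<in>V. H v b * w b) + t\<^sup>2 * H v v"
    proof -
      have "(\<Sum>a\<in>V. H a v * w a) = (\<Sum>a\<in>V. H v a * w a)"
        using sym v by (intro sum.cong) auto
      then show ?thesis using fin v by (simp add: sum.distrib flip: sum_distrib_left)
    qed
    finally show ?thesis using eq 1 by (simp add: g_def D_def algebra_simps)
  qed
  have nonneg: "0 \<le> 2 * t * g + t\<^sup>2 * D" for t
    using max[of "\<lambda>a. w a + t * (if a = v then 1 else 0)"] expand[of t] by linarith
  have "g = 0"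
  proof (rule ccontr)
    assume "g \<noteq> 0"
    \<comment> \<open>\<open>E\<close> is positive and exceeds \<open>D\<close>, so at
      \<open>t = - g / E\<close> the linear term outweighs the quadratic one, whatever the sign of
      \<open>D\<close>.\<close>
    define E where "E = \<bar>D\<bar> + 1"
    have E: "E > 0" "D < E" by (auto simp: E_def)
    have "0 \<le> 2 * (- g / E) * g + (- g / E)\<^sup>2 * D" by (rule nonneg)
    also have "\<dots> = (g\<^sup>2 / E\<^sup>2) * (D - 2 * E)"
      using E by (simp add: field_simps power2_eq_square)
    also have "\<dots> < 0" using E \<open>g \<noteq> 0\<close> by (intro mult_pos_neg) auto
    finally show False by simp
  qed
  then show "(\<Sum>b\<in>V. H v b * w b) = c * w v" by (simp add: g_def)
qed

section \<open>Perron-Frobenius theory of symmetric nonnegative matrices\<close>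

text \<open>Connectivity of the graph of nonzero entries, phrased by sets closed under adjacency:
  the zero set of an eigenvector can be inserted directly for \<open>R\<close>.\<close>

definition graph_connected :: "'a set \<Rightarrow> ('a \<Rightarrow> 'a \<Rightarrow> real) \<Rightarrow> bool" where
  "graph_connected V H \<longleftrightarrow> (\<forall>R\<subseteq>V. R \<noteq> {} \<longrightarrow>
     (\<forall>a\<in>V. \<forall>b\<in>V. H a b \<noteq> 0 \<longrightarrow> (a \<in> R \<longleftrightarrow> b \<in> R)) \<longrightarrow> R = V)"

lemma graph_connectedD:
  assumes "graph_connected V H" "R \<subseteq> V" "R \<noteq> {}"
    and "\<And>a b. a \<in> V \<Longrightarrow> b \<in> V \<Longrightarrow> H a b \<noteq> 0 \<Longrightarrow> a \<in> R \<longleftrightarrow> b \<in> R"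
  shows "R = V"
  using assms unfolding graph_connected_def by blast

text \<open>Passing to absolute values does not decrease the quadratic form of a nonnegative matrix,
  so \<open>\<bar>w\<bar>\<close> is again a maximizer and hence an eigenvector; its zero set is a union of components.\<close>

lemma maximizer_nonzero:
  assumes fin: "finite V" and sym: "\<And>a b. a \<in> V \<Longrightarrow> b \<in> V \<Longrightarrow> H a b = H b a"
    and nonneg: "\<And>a b. a \<in> V \<Longrightarrow> b \<in> V \<Longrightarrow> 0 \<le> H a b" and conn: "graph_connected V H"
    and max: "\<And>y. quad V H y \<le> c * sqnorm V y" and ev: "eigvec V H c w"
    and nz: "v \<in> V" "w v \<noteq> 0"
  shows "eigvec V H c (\<lambda>a. \<bar>w a\<bar>)" and "\<forall>a\<in>V. w a \<noteq> 0"
proof -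
  have "c * sqnorm V w = quad V H w" using ev by (simp add: quad_eigvec)
  also have "\<dots> \<le> quad V H (\<lambda>a. \<bar>w a\<bar>)"
    unfolding quad_def
  proof (intro sum_mono)
    fix a b assume "a \<in> V" "b \<in> V"
    then show "H a b * w a * w b \<le> H a b * \<bar>w a\<bar> * \<bar>w b\<bar>"
      using nonneg[of a b] abs_ge_self[of "w a * w b"] mult_left_mono
      by (fastforce simp: abs_mult mult.assoc)
  qed
  finally have "quad V H (\<lambda>a. \<bar>w a\<bar>) = c * sqnorm V (\<lambda>a. \<bar>w a\<bar>)"
    using max[of "\<lambda>a. \<bar>w a\<bar>"] by (simp add: sqnorm_def)
  from maximizer_eigvec[OF fin sym max this]
  show ev': "eigvec V H c (\<lambda>a. \<bar>w a\<bar>)" by auto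
  have step: "w b = 0" if "a \<in> V" "b \<in> V" "H a b \<noteq> 0" "w a = 0" for a b
  proof -
    have "(\<Sum>b\<in>V. H a b * \<bar>w b\<bar>) = 0" using ev' that by (simp add: eigvec_def)
    then have "H a b * \<bar>w b\<bar> = 0"
      using fin nonneg that by (subst (asm) sum_nonneg_eq_0_iff) auto
    then show ?thesis using that by simp
  qed
  have sym': "H b a \<noteq> 0" if "H a b \<noteq> 0" "a \<in> V" "b \<in> V" for a b using that sym by metis
  show "\<forall>a\<in>V. w a \<noteq> 0"
  proof (rule ccontr)
    assume "\<not> (\<forall>a\<in>V. w a \<noteq> 0)"
    then have "{a\<in>V. w a = 0} = V"
      using step sym' by (intro graph_connectedD[OF conn]) auto
    then show False using nz by auto
  qed
qed

text \<open>Besides \<open>w\<close>, also \<open>w - \<bar>w\<bar>\<close> satisfies the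
  eigenvector equation for \<open>c\<close>, so it vanishes everywhere or nowhere on
  \<open>V\<close>.\<close>

lemma maximizer_same_sign:
  assumes fin: "finite V" and sym: "\<And>a b. a \<in> V \<Longrightarrow> b \<in> V \<Longrightarrow> H a b = H b a"
    and nonneg: "\<And>a b. a \<in> V \<Longrightarrow> b \<in> V \<Longrightarrow> 0 \<le> H a b" and conn: "graph_connected V H"
    and max: "\<And>y. quad V H y \<le> c * sqnorm V y" and ev: "eigvec V H c w"
    and nz: "v \<in> V" "w v \<noteq> 0"
  shows "(\<forall>a\<in>V. w a > 0) \<or> (\<forall>a\<in>V. w a < 0)"
proof -
  have abs_ev: "eigvec V H c (\<lambda>a. \<bar>w a\<bar>)" and nz': "\<forall>a\<in>V. w a \<noteq> 0"
    using maximizer_nonzero[of V H c w v] assms by auto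
  have "eigvec V H c (\<lambda>a. w a - \<bar>w a\<bar>)"
    using ev abs_ev by (simp add: eigvec_def right_diff_distrib sum_subtractf)
  then have "(\<forall>a\<in>V. w a - \<bar>w a\<bar> = 0) \<or> (\<forall>a\<in>V. w a - \<bar>w a\<bar> \<noteq> 0)"
    using maximizer_nonzero(2)[of V H c "\<lambda>a. w a - \<bar>w a\<bar>"] assms by blast
  moreover note nz'
  ultimately show ?thesis
    by (force simp: abs_if split: if_splits)
qed

lemma quad_add_scaled:
  "quad V (\<lambda>a b. H a b + t * N a b) y = quad V H y + t * quad V N y"
  by (simp add: quad_def algebra_simps sum.distrib sum_distrib_left)

text \<open>The inequality \<open>2 * y a * y b \<le> (p b / p a) * (y a)\<^sup>2 + (p a / p b) * (y
  b)\<^sup>2\<close> is summed with weights \<open>H a b / 2\<close>, and the eigenvector equation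
  for \<open>p\<close> evaluates the right-hand side. So a positive eigenvector belongs to the
  largest eigenvalue.\<close>

lemma positive_eigvec_quad_le:
  assumes sym: "\<And>a b. a \<in> V \<Longrightarrow> b \<in> V \<Longrightarrow> H a b = H b a"
    and nonneg: "\<And>a b. a \<in> V \<Longrightarrow> b \<in> V \<Longrightarrow> 0 \<le> H a b"
    and ev: "eigvec V H c p" and pos: "\<And>a. a \<in> V \<Longrightarrow> 0 < p a"
  shows "quad V H y \<le> c * sqnorm V y"
proof -
  let ?f = "\<lambda>a b. H a b * p b * ((y a)\<^sup>2 / p a)"
  have "quad V H y \<le> (\<Sum>a\<in>V. \<Sum>b\<in>V. (?f a b + ?f b a) / 2)"
    unfolding quad_def
  proof (intro sum_mono)
    fix a b assume ab: "a \<in> V" "b \<in> V"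
    have "(?f a b + ?f b a) / 2 - H a b * y a * y b =
        H a b * (p b * y a - p a * y b)\<^sup>2 / (2 * p a * p b)"
      using pos[OF ab(1)] pos[OF ab(2)] sym[OF ab] by (simp add: field_simps power2_eq_square)
    also have "\<dots> \<ge> 0" using pos[OF ab(1)] pos[OF ab(2)] nonneg[OF ab] by simp
    finally show "H a b * y a * y b \<le> (?f a b + ?f b a) / 2" by simp
  qed
  also have "\<dots> = (\<Sum>a\<in>V. \<Sum>b\<in>V. ?f a b)"
  proof -
    have "(\<Sum>a\<in>V. \<Sum>b\<in>V. (?f a b + ?f b a) / 2) =
        ((\<Sum>a\<in>V. \<Sum>b\<in>V. ?f a b) + (\<Sum>a\<in>V. \<Sum>b\<in>V. ?f b a)) / 2"
      by (simp only: sum_divide_distrib sum.distrib add_divide_distrib)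
    then show ?thesis using sum.swap[of ?f V V] by simp
  qed
  also have "\<dots> = (\<Sum>a\<in>V. (c * p a) * ((y a)\<^sup>2 / p a))"
  proof (intro sum.cong refl)
    fix a assume "a \<in> V"
    then have "(\<Sum>b\<in>V. H a b * p b) = c * p a" using ev by (simp add: eigvec_def)
    then show "(\<Sum>b\<in>V. ?f a b) = (c * p a) * ((y a)\<^sup>2 / p a)"
      by (simp only: sum_distrib_right[symmetric])
  qed
  also have "\<dots> = c * sqnorm V y"
    unfolding sqnorm_def sum_distrib_left
  proof (intro sum.cong refl)
    show "c * p a * ((y a)\<^sup>2 / p a) = c * (y a)\<^sup>2" if "a \<in> V" for a
      using pos[OF that] by simp
  qed
  finally show ?thesis .
qed

section \<open>First-order conditions at a minimum of the largest eigenvalue\<close>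

definition independent_pair :: "'a set \<Rightarrow> ('a \<Rightarrow> real) \<Rightarrow> ('a \<Rightarrow> real) \<Rightarrow> bool" where
  "independent_pair V w w' \<longleftrightarrow>
    (\<forall>\<alpha> \<beta>. (\<forall>a\<in>V. \<alpha> * w a + \<beta> * w' a = 0) \<longrightarrow> \<alpha> = 0 \<and> \<beta> = 0)"

text \<open>A one-sided derivative test. Unit maximizers for \<open>H + t N\<close> with small
  \<open>t > 0\<close> cannot do better than \<open>maxev V H\<close> in the form of
  \<open>H\<close>, so the form of \<open>N\<close> is nonnegative at them; a limit point as
  \<open>t\<close> tends to 0 maximizes the form of \<open>H\<close>.\<close>

lemma minimal_maxev_ascent:
  assumes V: "finite V" "V \<noteq> {}"
    and min: "\<And>t. t > 0 \<Longrightarrow> maxev V H \<le> maxev V (\<lambda>a b. H a b + t * N a b)"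
  obtains w where "sqnorm V w = 1" "quad V H w = maxev V H" "0 \<le> quad V N w"
proof -
  define t where "t k = 1 / real (Suc k)" for k
  have t: "t k > 0" for k by (simp add: t_def)
  have t0: "t \<longlonglongrightarrow> 0" unfolding t_def by (intro LIMSEQ_Suc lim_1_over_n)
  let ?H = "\<lambda>k a b. H a b + t k * N a b"
  have "\<forall>k. \<exists>w. sqnorm V w = 1 \<and> quad V (?H k) w = maxev V (?H k)"
    by (rule allI, rule ex_maximizer[OF V]) blast
  from choice[OF this] obtain w
    where "\<forall>k. sqnorm V (w k) = 1 \<and> quad V (?H k) (w k) = maxev V (?H k)" by blast
  then have w1: "\<And>k. sqnorm V (w k) = 1"
    and wm: "\<And>k. quad V (?H k) (w k) = maxev V (?H k)" by blast+
  have pos: "0 \<le> quad V N (w k)" for k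
  proof -
    have "quad V H (w k) \<le> maxev V H" using quad_le_maxev[OF V, of H "w k"] w1 by simp
    also have "\<dots> \<le> quad V H (w k) + t k * quad V N (w k)"
      using min[OF t, of k] wm[of k] by (simp add: quad_add_scaled)
    finally have "0 \<le> t k * quad V N (w k)" by simp
    then show ?thesis using t[of k] by (simp add: zero_le_mult_iff)
  qed
  obtain r l where r: "strict_mono (r :: nat \<Rightarrow> nat)" and l: "\<And>a. a \<in> V \<Longrightarrow> (\<lambda>k. w (r k) a) \<longlonglongrightarrow> l a"
    using pointwise_convergent_subseq[OF V(1), of w 1] abs_le_1_if_sqnorm_1[OF V(1) w1] by metis
  have H: "(\<lambda>k. ?H (r k) a b) \<longlonglongrightarrow> H a b" for a b
    using tendsto_add[OF tendsto_const[of "H a b"] tendsto_mult_left[OF LIMSEQ_subseq_LIMSEQ[OF t0 r], of "N a b"]]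
    by (simp add: o_def mult.commute)
  show thesis
  proof (rule that)
    show "sqnorm V l = 1" using sqnorm_1_limit[of V "\<lambda>k. w (r k)" l] w1 l by auto
    have "(\<lambda>k. quad V (?H (r k)) (w (r k))) \<longlonglongrightarrow> quad V H l"
      using H l by (intro quad_tendsto) auto
    moreover have "(\<lambda>k. maxev V (?H (r k))) \<longlonglongrightarrow> maxev V H"
      using H by (intro maxev_tendsto[OF V]) auto
    ultimately show "quad V H l = maxev V H"
      unfolding wm by (rule LIMSEQ_unique)
    have "(\<lambda>k. quad V N (w (r k))) \<longlonglongrightarrow> quad V N l"
      using l by (intro quad_tendsto) auto
    then show "0 \<le> quad V N l" using pos by (intro LIMSEQ_le_const) auto
  qed
qed

text \<open>The one-sided test applies to \<open>N\<close> and to \<open>- N\<close>. As the top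
  eigenvalue is simple, both resulting vectors are nonzero multiples of \<open>w\<close>, and the
  forms change by a positive factor only.\<close>

lemma minimal_maxev_stationary:
  assumes V: "finite V" "V \<noteq> {}" and sym: "\<And>a b. a \<in> V \<Longrightarrow> b \<in> V \<Longrightarrow> H a b = H b a"
    and min: "\<And>t. maxev V H \<le> maxev V (\<lambda>a b. H a b + t * N a b)"
    and simple: "\<And>w w'. eigvec V H (maxev V H) w \<Longrightarrow> eigvec V H (maxev V H) w' \<Longrightarrow> \<not> independent_pair V w w'"
    and w: "sqnorm V w = 1" "quad V H w = maxev V H"
  shows "quad V N w = 0"
proof -
  have ev: "eigvec V H (maxev V H) y" if "sqnorm V y = 1" "quad V H y = maxev V H" for y
    using maximizer_eigvec[of V H "maxev V H" y] V sym quad_le_maxev[OF V] that by auto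
  have multiple: "\<exists>g. g\<^sup>2 > 0 \<and> quad V N y = g\<^sup>2 * quad V N w"
    if y: "sqnorm V y = 1" "quad V H y = maxev V H" for N y
  proof -
    obtain \<alpha> \<beta> where ab: "\<forall>a\<in>V. \<alpha> * w a + \<beta> * y a = 0" "\<alpha> \<noteq> 0 \<or> \<beta> \<noteq> 0"
      using simple[OF ev[OF w] ev[OF y]] by (auto simp: independent_pair_def)
    have "\<beta> \<noteq> 0"
    proof
      assume "\<beta> = 0"
      then have "\<forall>a\<in>V. w a = 0" using ab by auto
      then show False using w(1) by (simp add: sqnorm_def)
    qed
    have "\<alpha> \<noteq> 0"
    proof
      assume "\<alpha> = 0"
      then have "\<forall>a\<in>V. y a = 0" using ab by auto
      then show False using y(1) by (simp add: sqnorm_def)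
    qed
    have "y a = (- \<alpha> / \<beta>) * w a" if "a \<in> V" for a
      using ab(1) that \<open>\<beta> \<noteq> 0\<close> by (simp add: field_simps eq_neg_iff_add_eq_0 add.commute)
    then have "quad V N y = quad V N (\<lambda>a. (- \<alpha> / \<beta>) * w a)"
      by (simp add: quad_def)
    then show ?thesis using \<open>\<alpha> \<noteq> 0\<close> \<open>\<beta> \<noteq> 0\<close> quad_scale[of V N "- \<alpha> / \<beta>" w]
      by (intro exI[of _ "- \<alpha> / \<beta>"]) auto
  qed
  obtain y where "sqnorm V y = 1" "quad V H y = maxev V H" "0 \<le> quad V N y"
    using minimal_maxev_ascent[OF V, of H N] min by metis
  then have "0 \<le> quad V N w"
    using multiple[of y N] by (metis zero_le_mult_iff not_less)
  moreover obtain y' where "sqnorm V y' = 1" "quad V H y' = maxev V H"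
      "0 \<le> quad V (\<lambda>a b. - N a b) y'"
  proof (rule minimal_maxev_ascent[OF V, of H "\<lambda>a b. - N a b"])
    show "maxev V H \<le> maxev V (\<lambda>a b. H a b + t * - N a b)" for t
      using min[of "- t"] by simp
  qed
  then have "0 \<le> quad V (\<lambda>a b. - N a b) w"
    using multiple[of y' "\<lambda>a b. - N a b"] by (metis zero_le_mult_iff not_less)
  then have "quad V N w \<le> 0"
    by (simp add: quad_def sum_negf)
  ultimately show ?thesis by simp
qed

subsection \<open>Minimizing the largest eigenvalue\<close>

definition edge :: "'a \<Rightarrow> 'a \<Rightarrow> 'a \<Rightarrow> 'a \<Rightarrow> real" where
  "edge a b q r = of_bool (q = a \<and> r = b \<or> q = b \<and> r = a)"

lemma edge_commute: "edge a b q r = edge a b r q"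
  by (auto simp: edge_def)

lemma quad_edge:
  assumes "finite V" "a \<in> V" "b \<in> V" "a \<noteq> b"
  shows "quad V (edge a b) y = 2 * y a * y b"
proof -
  have "(\<Sum>r\<in>V. edge a b q r * y q * y r) = (if q = a then y a * y b else 0) + (if q = b then y a * y b else 0)"
    if "q \<in> V" for q
  proof -
    have "(\<Sum>r\<in>V. edge a b q r * y q * y r) =
      (\<Sum>r\<in>V. (if r = b then (if q = a then y a * y b else 0) else 0) + (if r = a then (if q = b then y a * y b else 0) else 0))"
      using assms by (intro sum.cong) (auto simp: edge_def)
    then show ?thesis using assms by (simp add: sum.distrib)
  qed
  then show ?thesis using assms by (simp add: quad_def sum.distrib)
qed

section \<open>The two-block perturbation family\<close>

text \<open>Later \<open>H\<close> is the bipartite matrix of the direct sum of \<open>A\<close> and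
  \<open>B\<close>, with Perron vector \<open>p\<close> for the common largest eigenvalue 1.
  \<open>K\<close> carries the fixed entries of \<open>E\<close> and \<open>F\<close>, the pair
  \<open>a\<close>, \<open>b\<close> is the position of the free entry, and \<open>c\<close>,
  \<open>d\<close> is a second position, which joins the blocks when the free entry is 0.\<close>

locale two_blocks =
  fixes V1 V2 :: "'a set" and H K :: "'a \<Rightarrow> 'a \<Rightarrow> real" and p :: "'a \<Rightarrow> real" and a b c d :: 'a
  assumes fin: "finite V1" "finite V2" and disj: "V1 \<inter> V2 = {}"
    and H_sym: "\<And>q r. H q r = H r q" and H_nonneg: "\<And>q r. 0 \<le> H q r"
    and H_across: "\<And>q r. q \<in> V1 \<Longrightarrow> r \<in> V2 \<Longrightarrow> H q r = 0"
    and conn: "graph_connected V1 H" "graph_connected V2 H"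
    and p_pos: "\<And>q. q \<in> V1 \<union> V2 \<Longrightarrow> 0 < p q" and p_ev: "eigvec (V1 \<union> V2) H 1 p"
    and K_sym: "\<And>q r. K q r = K r q" and K_nonneg: "\<And>q r. 0 \<le> K q r"
    and K_within: "\<And>q r. q \<in> V1 \<Longrightarrow> r \<in> V1 \<Longrightarrow> K q r = 0" "\<And>q r. q \<in> V2 \<Longrightarrow> r \<in> V2 \<Longrightarrow> K q r = 0"
    and ab: "a \<in> V1" "b \<in> V2" and cd: "c \<in> V1" "d \<in> V2" "0 < K c d"
begin

text \<open>\<open>e * K\<close> couples the two blocks, and \<open>s\<close> and \<open>x\<close> are the parameters over which the largest
  eigenvalue of \<open>pert s e x\<close> is minimized.\<close>

definition "V = V1 \<union> V2"
definition "sg q = (if q \<in> V1 then 1 else -1 :: real)"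
definition "sgH q r = sg q * H q r"
definition "pert s e x q r = (1 + s * sg q) * H q r + e * K q r + x * edge a b q r"
definition "n1 = sqnorm V1 p"
definition "n2 = sqnorm V2 p"
definition "kp = quad V K p"
definition "C = (\<Sum>q\<in>V. \<Sum>r\<in>V. \<bar>K q r\<bar>)"

lemma V: "finite V" "V \<noteq> {}" "a \<in> V" "b \<in> V" "a \<noteq> b"
  using fin ab disj by (auto simp: V_def)

lemma H_across': "q \<in> V2 \<Longrightarrow> r \<in> V1 \<Longrightarrow> H q r = 0"
  using H_across H_sym by metis

lemma sum_V: "(\<Sum>q\<in>V. f q) = (\<Sum>q\<in>V1. f q) + (\<Sum>q\<in>V2. f q)"
  using fin disj by (simp add: V_def sum.union_disjoint)

lemma sqnorm_V: "sqnorm V y = sqnorm V1 y + sqnorm V2 y"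
  by (simp add: sqnorm_def sum_V)

lemma eigvec_blocks: "eigvec V H t y \<longleftrightarrow> eigvec V1 H t y \<and> eigvec V2 H t y"
proof -
  have "(\<Sum>r\<in>V. H q r * y r) = (\<Sum>r\<in>V1. H q r * y r)" if "q \<in> V1" for q
    using H_across that by (simp add: sum_V)
  moreover have "(\<Sum>r\<in>V. H q r * y r) = (\<Sum>r\<in>V2. H q r * y r)" if "q \<in> V2" for q
    using H_across' that by (simp add: sum_V)
  ultimately show ?thesis by (auto simp: eigvec_def V_def)
qed

text \<open>The factor \<open>1 + s * sg q\<close> depends on the row only; symmetry holds since
  \<open>sg q = sg r\<close> whenever \<open>H q r\<close> is nonzero.\<close>

lemma pert_sym: "q \<in> V \<Longrightarrow> r \<in> V \<Longrightarrow> pert s e x q r = pert s e x r q"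
  using H_across H_across' disj
  by (auto simp: pert_def H_sym[of q r] K_sym[of q r] edge_commute[of a b q r] V_def sg_def)

lemma quad_pert:
  "quad V (pert s e x) y = quad V H y + s * quad V sgH y + e * quad V K y + x * (2 * y a * y b)"
proof -
  have "pert s e x = (\<lambda>q r. ((H q r + s * sgH q r) + e * K q r) + x * edge a b q r)"
    by (simp add: pert_def sgH_def fun_eq_iff algebra_simps)
  then show ?thesis using quad_edge[of V a b y] V by (simp add: quad_add_scaled)
qed

text \<open>The eigenvector equation reduces the inner sum to \<open>y q\<close>. Together with
  stationarity in \<open>s\<close> this will give equal norms on the two blocks.\<close>

lemma quad_sgH: "eigvec V H 1 y \<Longrightarrow> quad V sgH y = sqnorm V1 y - sqnorm V2 y"
proof -
  assume ev: "eigvec V H 1 y"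
  have "quad V sgH y = (\<Sum>q\<in>V. sg q * y q * (\<Sum>r\<in>V. H q r * y r))"
    by (simp add: quad_def sgH_def sum_distrib_left mult_ac)
  also have "\<dots> = (\<Sum>q\<in>V. sg q * (y q)\<^sup>2)"
    using ev by (simp add: eigvec_def power2_eq_square mult_ac)
  also have "\<dots> = (\<Sum>q\<in>V1. sg q * (y q)\<^sup>2) + (\<Sum>q\<in>V2. sg q * (y q)\<^sup>2)"
    by (rule sum_V)
  also have "(\<Sum>q\<in>V2. sg q * (y q)\<^sup>2) = (\<Sum>q\<in>V2. - (y q)\<^sup>2)"
    using disj by (intro sum.cong) (auto simp: sg_def)
  finally show ?thesis
    by (simp add: sqnorm_def sg_def sum_negf)
qed

lemma quad_H_le: "quad V H y \<le> sqnorm V y"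
  using positive_eigvec_quad_le[of V H 1 p y] H_sym H_nonneg p_ev p_pos
  by (simp add: V_def)

text \<open>Rescaling \<open>p\<close> separately on the blocks preserves the eigenvector equation,
  because \<open>H\<close> does not couple them, so these test vectors have explicit values; all
  coupling terms carry the factor \<open>\<alpha> * \<beta>\<close>.\<close>

lemma quad_test:
  fixes \<alpha> \<beta> :: real
  defines "y \<equiv> \<lambda>q. if q \<in> V1 then \<alpha> * p q else \<beta> * p q"
  shows "sqnorm V y = \<alpha>\<^sup>2 * n1 + \<beta>\<^sup>2 * n2"
    and "quad V (pert s e x) y = (1 + s) * \<alpha>\<^sup>2 * n1 + (1 - s) * \<beta>\<^sup>2 * n2
      + \<alpha> * \<beta> * (e * kp + 2 * x * p a * p b)"
proof -
  have y2: "y q = \<beta> * p q" if "q \<in> V2" for q using that disj by (auto simp: y_def)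
  have y1: "y q = \<alpha> * p q" if "q \<in> V1" for q using that by (auto simp: y_def)
  have s1: "sqnorm V1 y = \<alpha>\<^sup>2 * n1"
    unfolding n1_def sqnorm_scale[symmetric] using y1 by (simp add: sqnorm_def)
  have s2: "sqnorm V2 y = \<beta>\<^sup>2 * n2"
    unfolding n2_def sqnorm_scale[symmetric] using y2 by (simp add: sqnorm_def)
  show sV: "sqnorm V y = \<alpha>\<^sup>2 * n1 + \<beta>\<^sup>2 * n2" using s1 s2 by (simp add: sqnorm_V)
  have "eigvec V1 H 1 p" "eigvec V2 H 1 p" using p_ev eigvec_blocks[of 1 p] by (simp_all add: V_def)
  then have "eigvec V1 H 1 y" "eigvec V2 H 1 y"
    by (simp_all add: eigvec_def y1 y2 mult.left_commute[of _ \<alpha>] mult.left_commute[of _ \<beta>] flip: sum_distrib_left)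
  then have ev: "eigvec V H 1 y" by (simp add: eigvec_blocks)
  have "K q r * y q * y r = \<alpha> * \<beta> * (K q r * p q * p r)" if "q \<in> V" "r \<in> V" for q r
    using that K_within by (auto simp: V_def y1 y2)
  then have "quad V K y = \<alpha> * \<beta> * kp"
    unfolding quad_def kp_def sum_distrib_left by (intro sum.cong refl) auto
  then show "quad V (pert s e x) y = (1 + s) * \<alpha>\<^sup>2 * n1 + (1 - s) * \<beta>\<^sup>2 * n2
      + \<alpha> * \<beta> * (e * kp + 2 * x * p a * p b)"
    unfolding quad_pert quad_sgH[OF ev] quad_eigvec[OF ev] sV s1 s2 y1[OF ab(1)] y2[OF ab(2)]
    by (simp add: algebra_simps)
qed

lemma n_pos: "n1 > 0" "n2 > 0"
proof -
  have "n1 \<noteq> 0" "n2 \<noteq> 0"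
    unfolding n1_def n2_def using ab p_pos[of a] p_pos[of b] fin
    by (auto simp: sqnorm_eq_0_iff intro: bexI[of _ a] bexI[of _ b])
  then show "n1 > 0" "n2 > 0"
    using sqnorm_nonneg[of V1 p] sqnorm_nonneg[of V2 p] by (auto simp: n1_def n2_def)
qed

lemma kp_nonneg: "kp \<ge> 0"
  unfolding kp_def quad_def V_def using K_nonneg p_pos[THEN less_imp_le]
  by (intro sum_nonneg mult_nonneg_nonneg) blast+

lemma C_nonneg: "C \<ge> 0"
  unfolding C_def by (intro sum_nonneg) auto

text \<open>Test vectors supported on one block give \<open>1 + s\<close> and \<open>1 - s\<close>.
  The bound confines \<open>s\<close> at a minimizer.\<close>

lemma maxev_pert_ge: "1 + \<bar>s\<bar> \<le> maxev V (pert s e x)"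
proof -
  have "(1 + s) * n1 \<le> maxev V (pert s e x) * n1"
    using quad_le_maxev[OF V(1,2), of "pert s e x" "\<lambda>q. if q \<in> V1 then 1 * p q else 0 * p q"]
    unfolding quad_test by simp
  moreover have "(1 - s) * n2 \<le> maxev V (pert s e x) * n2"
    using quad_le_maxev[OF V(1,2), of "pert s e x" "\<lambda>q. if q \<in> V1 then 0 * p q else 1 * p q"]
    unfolding quad_test by simp
  ultimately show ?thesis using n_pos by (simp add: abs_real_def)
qed

text \<open>The weights \<open>(1, 1)\<close> and \<open>(1, -1)\<close> in \<open>quad_test\<close>
  bound \<open>x\<close> from both sides.\<close>

lemma abs_edge_weight_le:
  assumes "e \<ge> 0"
  shows "2 * \<bar>x\<bar> * (p a * p b) \<le> (maxev V (pert s e x) - 1 + \<bar>s\<bar>) * (n1 + n2) + e * kp"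
proof -
  let ?l = "maxev V (pert s e x)"
  have "(1 + s) * n1 + (1 - s) * n2 + (e * kp + 2 * x * p a * p b) \<le> ?l * (n1 + n2)"
    using quad_le_maxev[OF V(1,2), of "pert s e x" "\<lambda>q. if q \<in> V1 then 1 * p q else 1 * p q"]
    unfolding quad_test by simp
  moreover have "(1 + s) * n1 + (1 - s) * n2 - (e * kp + 2 * x * p a * p b) \<le> ?l * (n1 + n2)"
    using quad_le_maxev[OF V(1,2), of "pert s e x" "\<lambda>q. if q \<in> V1 then 1 * p q else -1 * p q"]
    unfolding quad_test by simp
  moreover have "(1 + s) * n1 + (1 - s) * n2 \<ge> (1 - \<bar>s\<bar>) * (n1 + n2)"
  proof -
    have "(1 - \<bar>s\<bar>) * n1 \<le> (1 + s) * n1" "(1 - \<bar>s\<bar>) * n2 \<le> (1 - s) * n2"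
      using n_pos by (auto intro!: mult_right_mono)
    then show ?thesis by (simp add: distrib_left)
  qed
  moreover have "0 \<le> e * kp" using assms kp_nonneg by simp
  ultimately have "\<bar>2 * x * p a * p b\<bar> \<le> (?l - 1 + \<bar>s\<bar>) * (n1 + n2) + e * kp"
    unfolding abs_le_iff by (simp add: algebra_simps)
  moreover have "\<bar>2 * x * p a * p b\<bar> = 2 * \<bar>x\<bar> * (p a * p b)"
    using p_pos[of a] p_pos[of b] ab by (simp add: abs_mult)
  ultimately show ?thesis by simp
qed

lemma maxev_H: "maxev V H = 1"
proof -
  have "maxev V H \<ge> 1"
    using maxev_pert_ge[of 0 0 0] by (simp add: pert_def[abs_def])
  moreover obtain w where "sqnorm V w = 1" "quad V H w = maxev V H"
    using ex_maximizer[OF V(1,2)] by metis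
  ultimately show ?thesis using quad_H_le[of w] by simp
qed

lemma maxev_pert_0_le: "e \<ge> 0 \<Longrightarrow> maxev V (pert 0 e 0) \<le> 1 + e * C"
  using maxev_le_add[OF V(1,2), of "pert 0 e 0" H]
  by (simp add: maxev_H pert_def C_def sum_distrib_left abs_mult)

lemma pert_tendsto:
  assumes "s \<longlonglongrightarrow> s'" "e \<longlonglongrightarrow> e'" "x \<longlonglongrightarrow> x'"
  shows "(\<lambda>k. pert (s k) (e k) (x k) q r) \<longlonglongrightarrow> pert s' e' x' q r"
  unfolding pert_def using assms by (intro tendsto_intros)

text \<open>A point that beats the minimizer over a compact rectangle would have value below 2, and
  the two preceding lower bounds place it inside the rectangle; so the minimum is global. Comparing
  with the value at \<open>s = x = 0\<close> makes both parameters of order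
  \<open>e\<close>.\<close>

lemma ex_minimizer:
  assumes e: "0 \<le> e" "e * C \<le> 1"
  obtains s x where "\<And>s' x'. maxev V (pert s e x) \<le> maxev V (pert s' e x')"
    and "\<bar>s\<bar> \<le> e * C" and "\<bar>x\<bar> \<le> e * ((2 * C * (n1 + n2) + kp) / (2 * (p a * p b)))"
proof -
  \<comment> \<open>A pair \<open>(s, x)\<close> is coded as a function on \<open>bool\<close>, with
    \<open>True\<close> for \<open>s\<close> and \<open>False\<close> for \<open>x\<close>, so that
    \<open>attains_inf_seq\<close> applies.\<close>
  let ?f = "\<lambda>y. maxev V (pert (y True) e (y False))"
  \<comment> \<open>The bound that \<open>abs_edge_weight_le\<close> puts on
    \<open>\<bar>x\<bar>\<close> when the largest eigenvalue is at most 2 and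
    \<open>\<bar>s\<bar> \<le> 1\<close>.\<close>
  define B where "B = (2 * (n1 + n2) + e * kp) / (2 * (p a * p b))"
  have pab: "p a * p b > 0" using p_pos[of a] p_pos[of b] ab by simp
  have B0: "B \<ge> 0" unfolding B_def using pab n_pos kp_nonneg e by simp
  let ?S = "{y. \<bar>y True\<bar> \<le> 1 \<and> \<bar>y False\<bar> \<le> B}"
  have "\<exists>y\<in>?S. \<forall>z\<in>?S. ?f y \<le> ?f z"
  proof (rule attains_inf_seq[of "UNIV :: bool set" ?S ?f "max 1 B"])
    show "?S \<noteq> {}" using B0 by (auto intro!: exI[of _ "\<lambda>_. 0"])
    show "bdd_below (?f ` ?S)"
    proof (rule bdd_belowI2)
      show "1 \<le> ?f y" for y using maxev_pert_ge[of "y True" e "y False"] by simp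
    qed
    show "\<bar>y i\<bar> \<le> max 1 B" if "y \<in> ?S" for y i using that by (cases i) auto
    show "l \<in> ?S" if "\<And>k. y k \<in> ?S" "\<And>i. i \<in> UNIV \<Longrightarrow> (\<lambda>k. y k i) \<longlonglongrightarrow> l i" for y l
      using that LIMSEQ_le_const2[OF tendsto_rabs[OF that(2)]] by auto
    show "(\<lambda>k. ?f (y k)) \<longlonglongrightarrow> ?f l"
      if "\<And>k. y k \<in> ?S" "\<And>i. i \<in> UNIV \<Longrightarrow> (\<lambda>k. y k i) \<longlonglongrightarrow> l i" for y l
      using that by (intro maxev_tendsto[OF V(1,2)] pert_tendsto) auto
  qed auto
  then obtain y where yS: "y \<in> ?S" and y: "\<And>z. z \<in> ?S \<Longrightarrow> ?f y \<le> ?f z" by blast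
  have le0: "?f y \<le> 1 + e * C"
    using y[of "\<lambda>_. 0"] B0 maxev_pert_0_le[OF e(1)] by simp
  show thesis
  proof (rule that)
    show "maxev V (pert (y True) e (y False)) \<le> maxev V (pert s' e x')" for s' x'
    proof (rule ccontr)
      assume "\<not> ?thesis"
      then have lt: "maxev V (pert s' e x') < 2" "maxev V (pert s' e x') < ?f y" using le0 e by auto
      then have s': "\<bar>s'\<bar> \<le> 1" using maxev_pert_ge[of s' e x'] by simp
      have "2 * \<bar>x'\<bar> * (p a * p b) \<le> 2 * (n1 + n2) + e * kp"
        using abs_edge_weight_le[OF e(1), of x' s'] lt s' n_pos
          mult_right_mono[of "maxev V (pert s' e x') - 1 + \<bar>s'\<bar>" 2 "n1 + n2"] by linarith
      then have "\<bar>x'\<bar> \<le> B" using pab by (simp add: B_def field_simps)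
      then show False using y[of "\<lambda>i. if i then s' else x'"] s' lt by simp
    qed
    show s: "\<bar>y True\<bar> \<le> e * C" using maxev_pert_ge[of "y True" e "y False"] le0 by simp
    have "2 * \<bar>y False\<bar> * (p a * p b) \<le> (2 * (e * C)) * (n1 + n2) + e * kp"
      using abs_edge_weight_le[OF e(1), of "y False" "y True"] le0 s n_pos
          mult_right_mono[of "?f y - 1 + \<bar>y True\<bar>" "2 * (e * C)" "n1 + n2"] by linarith
    then show "\<bar>y False\<bar> \<le> e * ((2 * C * (n1 + n2) + kp) / (2 * (p a * p b)))"
      using pab by (simp add: field_simps)
  qed
qed

text \<open>\<open>\<bar>s\<bar> < 1\<close> keeps the entries of \<open>H\<close> inside the blocks
  nonzero, hence each block connected; the entry at \<open>c\<close>, \<open>d\<close> joins the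
  blocks.\<close>

lemma graph_connected_pert:
  assumes "\<bar>s\<bar> < 1" "e > 0"
  shows "graph_connected V (pert s e 0)"
  unfolding graph_connected_def
proof (intro allI impI)
  fix R assume R: "R \<subseteq> V" "R \<noteq> {}"
    and closed: "\<forall>q\<in>V. \<forall>r\<in>V. pert s e 0 q r \<noteq> 0 \<longrightarrow> (q \<in> R) = (r \<in> R)"
  have H0: "pert s e 0 q r \<noteq> 0" if "H q r \<noteq> 0" "q \<in> V1 \<and> r \<in> V1 \<or> q \<in> V2 \<and> r \<in> V2" for q r
    using that assms K_within by (auto simp: pert_def sg_def)
  have 1: "R \<inter> V1 = V1" if "R \<inter> V1 \<noteq> {}"
    using closed H0 that by (intro graph_connectedD[OF conn(1)]) (auto simp: V_def)
  have 2: "R \<inter> V2 = V2" if "R \<inter> V2 \<noteq> {}"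
    using closed H0 that by (intro graph_connectedD[OF conn(2)]) (auto simp: V_def)
  have "pert s e 0 c d \<noteq> 0" using cd assms H_across by (simp add: pert_def)
  then have "c \<in> R \<longleftrightarrow> d \<in> R" using closed cd by (auto simp: V_def)
  then show "R = V" using 1 2 R cd by (auto simp: V_def)
qed

text \<open>For \<open>x = 0\<close> the matrix is nonnegative and connected, so every top eigenvector has constant
  sign and decreasing \<open>x\<close> lowers the largest eigenvalue.\<close>

lemma minimizer_edge_weight_nonzero:
  assumes e: "e > 0" and s: "\<bar>s\<bar> < 1"
    and min: "\<And>x'. maxev V (pert s e x) \<le> maxev V (pert s e x')"
  shows "x \<noteq> 0"
proof
  assume x: "x = 0"
  have "\<exists>w. sqnorm V w = 1 \<and> quad V (pert s e 0) w = maxev V (pert s e 0) \<and> 0 \<le> quad V (\<lambda>q r. - edge a b q r) w"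
  proof (rule minimal_maxev_ascent[OF V(1,2), of "pert s e 0" "\<lambda>q r. - edge a b q r"])
    show "maxev V (pert s e 0) \<le> maxev V (\<lambda>q r. pert s e 0 q r + t * - edge a b q r)" for t
      using min[of "- t"] x by (simp add: pert_def[abs_def])
  qed auto
  then obtain w where w: "sqnorm V w = 1" "quad V (pert s e 0) w = maxev V (pert s e 0)"
    and wab: "0 \<le> quad V (\<lambda>q r. - edge a b q r) w" by blast
  have "quad V (\<lambda>q r. - edge a b q r) w = - (2 * w a * w b)"
    using quad_edge[of V a b w] V by (simp add: quad_def sum_negf)
  then have "w a * w b \<le> 0" using wab by simp
  have "\<not> (\<forall>v\<in>V. w v = 0)" using w(1) V(1) by (metis sqnorm_eq_0_iff zero_neq_one)
  then obtain v where v: "v \<in> V" "w v \<noteq> 0" by blast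
  have "(\<forall>q\<in>V. w q > 0) \<or> (\<forall>q\<in>V. w q < 0)"
  proof (rule maximizer_same_sign[OF V(1) _ _ graph_connected_pert[OF s e]])
    show "quad V (pert s e 0) y \<le> maxev V (pert s e 0) * sqnorm V y" for y
      by (rule quad_le_maxev[OF V(1,2)])
    then show "eigvec V (pert s e 0) (maxev V (pert s e 0)) w"
      using w V pert_sym by (intro maximizer_eigvec) auto
    show "0 \<le> pert s e 0 q r" for q r
      using s e H_nonneg K_nonneg by (auto simp: pert_def sg_def)
  qed (use pert_sym v in auto)
  then have "w a * w b > 0" using V by (auto simp: mult_neg_neg)
  with \<open>w a * w b \<le> 0\<close> show False by simp
qed

text \<open>At a minimizer with simple largest eigenvalue both partial derivatives vanish. As \<open>e\<close> tends to
  0, this yields a top eigenvector \<open>l\<close> of \<open>H\<close> of equal norm on the two blocks and with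
  \<open>l a * l b = 0\<close>, contradicting connectivity of the blocks.\<close>

lemma ex_double_eigenvalue:
  assumes \<delta>: "\<delta> > 0"
  obtains s e x t w w' where "\<bar>s\<bar> < \<delta>" "0 < e" "e < \<delta>" "\<bar>x\<bar> < \<delta>" "x \<noteq> 0" "t > 0"
    "eigvec V (pert s e x) t w" "eigvec V (pert s e x) t w'" "independent_pair V w w'"
proof (rule ccontr)
  assume neg: "\<not> thesis"
  note result = that
  define D where "D = (2 * C * (n1 + n2) + kp) / (2 * (p a * p b))"
  \<comment> \<open>The factor \<open>1 / (C + 1)\<close> secures \<open>e k * C \<le> 1\<close>, as
    \<open>ex_minimizer\<close> requires.\<close>
  define e where "e k = (1 / (C + 1)) * (1 / real (Suc k))" for k
  have e: "e k > 0" "e k * C \<le> 1" for k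
  proof -
    show "e k > 0" using C_nonneg by (simp add: e_def)
    have "C * 1 \<le> (C + 1) * real (Suc k)" using C_nonneg by (intro mult_mono) auto
    then show "e k * C \<le> 1" using C_nonneg by (simp add: e_def divide_le_eq del: of_nat_Suc)
  qed
  have "e \<longlonglongrightarrow> (1 / (C + 1)) * 0"
    unfolding e_def by (intro tendsto_mult_left LIMSEQ_Suc lim_1_over_n)
  then have e0: "e \<longlonglongrightarrow> 0" by simp
  have "\<exists>s x. (\<forall>s' x'. maxev V (pert s (e k) x) \<le> maxev V (pert s' (e k) x'))
      \<and> \<bar>s\<bar> \<le> e k * C \<and> \<bar>x\<bar> \<le> e k * D" for k
    using ex_minimizer[of "e k"] e[of k] unfolding D_def by (metis less_imp_le)
  then obtain s x where min: "\<And>k s' x'. maxev V (pert (s k) (e k) (x k)) \<le> maxev V (pert s' (e k) x')"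
    and sb: "\<And>k. \<bar>s k\<bar> \<le> e k * C" and xb: "\<And>k. \<bar>x k\<bar> \<le> e k * D" by metis
  have s0: "s \<longlonglongrightarrow> 0"
    using sb e by (intro tendsto_0_le[OF e0, of _ C] always_eventually allI) (simp add: abs_of_pos)
  have x0: "x \<longlonglongrightarrow> 0"
    using xb e by (intro tendsto_0_le[OF e0, of _ D] always_eventually allI) (simp add: abs_of_pos)
  have "\<forall>\<^sub>F k in sequentially. e k < \<delta> \<and> \<bar>s k\<bar> < min \<delta> 1 \<and> \<bar>x k\<bar> < \<delta>"
    using order_tendstoD(2)[OF e0, of \<delta>] order_tendstoD(2)[OF tendsto_rabs_zero[OF s0], of "min \<delta> 1"]
      order_tendstoD(2)[OF tendsto_rabs_zero[OF x0], of \<delta>] \<delta>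
    by (simp add: eventually_conj_iff)
  then obtain k0 where k0: "\<And>k. k \<ge> k0 \<Longrightarrow> e k < \<delta> \<and> \<bar>s k\<bar> < min \<delta> 1 \<and> \<bar>x k\<bar> < \<delta>"
    by (auto simp: eventually_sequentially)
  define P where "P k = pert (s (k + k0)) (e (k + k0)) (x (k + k0))" for k
  have Psym: "q \<in> V \<Longrightarrow> r \<in> V \<Longrightarrow> P k q r = P k r q" for k q r
    unfolding P_def by (rule pert_sym)
  \<comment> \<open>An independent pair of top eigenvectors is what the negated goal rules out,
    \<open>x \<noteq> 0\<close> being guaranteed at a minimizer.\<close>
  have simple: "\<not> independent_pair V w w'"
    if ew: "eigvec V (P k) (maxev V (P k)) w" "eigvec V (P k) (maxev V (P k)) w'" for k w w'
  proof
    let ?k = "k + k0"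
    assume ind: "independent_pair V w w'"
    have "x ?k \<noteq> 0"
      using minimizer_edge_weight_nonzero[of "e ?k" "s ?k" "x ?k"] e[of ?k] k0[of ?k] min by auto
    moreover have "maxev V (P k) > 0"
      using maxev_pert_ge[of "s ?k" "e ?k" "x ?k"] by (simp add: P_def)
    ultimately show False
      using neg result[where s="s ?k" and e="e ?k" and x="x ?k"] k0[of ?k] e[of ?k] ind ew
      unfolding P_def by auto
  qed
  have "\<forall>k. \<exists>w. sqnorm V w = 1 \<and> quad V (P k) w = maxev V (P k)"
    by (rule allI, rule ex_maximizer[OF V(1,2)]) blast
  from choice[OF this] obtain w
    where "\<forall>k. sqnorm V (w k) = 1 \<and> quad V (P k) (w k) = maxev V (P k)" by blast
  then have w1: "\<And>k. sqnorm V (w k) = 1" and wm: "\<And>k. quad V (P k) (w k) = maxev V (P k)"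
    by blast+
  have st1: "quad V sgH (w k) = 0" for k
  proof (rule minimal_maxev_stationary[OF V(1,2) Psym _ simple w1 wm])
    show "maxev V (P k) \<le> maxev V (\<lambda>q r. P k q r + t * sgH q r)" for t
      using min[of "k + k0" "s (k + k0) + t" "x (k + k0)"]
      by (simp add: P_def pert_def[abs_def] sgH_def algebra_simps)
  qed auto
  have st2: "w k a * w k b = 0" for k
  proof -
    have "quad V (edge a b) (w k) = 0"
    proof (rule minimal_maxev_stationary[OF V(1,2) Psym _ simple w1 wm])
      show "maxev V (P k) \<le> maxev V (\<lambda>q r. P k q r + t * edge a b q r)" for t
        using min[of "k + k0" "s (k + k0)" "x (k + k0) + t"]
        by (simp add: P_def pert_def[abs_def] algebra_simps)
    qed auto
    then show ?thesis using quad_edge[of V a b "w k"] V by simp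
  qed
  obtain r l where r: "strict_mono (r :: nat \<Rightarrow> nat)" and l: "\<And>q. q \<in> V \<Longrightarrow> (\<lambda>k. w (r k) q) \<longlonglongrightarrow> l q"
    using pointwise_convergent_subseq[OF V(1), of w 1] abs_le_1_if_sqnorm_1[OF V(1) w1] by metis
  have P_lim: "(\<lambda>k. P (r k) q r') \<longlonglongrightarrow> H q r'" for q r'
  proof -
    have "(\<lambda>k. P k q r') \<longlonglongrightarrow> pert 0 0 0 q r'"
      unfolding P_def by (intro pert_tendsto LIMSEQ_ignore_initial_segment s0 e0 x0)
    from LIMSEQ_subseq_LIMSEQ[OF this r] show ?thesis by (simp add: o_def pert_def)
  qed
  have l1: "sqnorm V l = 1" using sqnorm_1_limit[of V "\<lambda>k. w (r k)" l] w1 l by auto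
  have "(\<lambda>k. quad V (P (r k)) (w (r k))) \<longlonglongrightarrow> quad V H l"
    using P_lim l by (intro quad_tendsto) auto
  moreover have "(\<lambda>k. maxev V (P (r k))) \<longlonglongrightarrow> maxev V H"
    using P_lim by (intro maxev_tendsto[OF V(1,2)]) auto
  ultimately have "quad V H l = 1"
    unfolding wm maxev_H by (rule LIMSEQ_unique)
  then have ev: "eigvec V H 1 l"
    using quad_H_le l1 H_sym by (intro maximizer_eigvec[OF V(1)]) auto
  have "(\<lambda>k. quad V sgH (w (r k))) \<longlonglongrightarrow> quad V sgH l"
    using l by (intro quad_tendsto) auto
  then have "quad V sgH l = 0" by (simp add: st1 LIMSEQ_const_iff)
  then have eq: "sqnorm V1 l = sqnorm V2 l" "sqnorm V1 l \<noteq> 0"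
    using quad_sgH[OF ev] l1 by (auto simp: sqnorm_V)
  have nz: "\<forall>q\<in>U. l q \<noteq> 0" if U: "U = V1 \<or> U = V2" for U
  proof -
    have fU: "finite U" using U fin by auto
    have "sqnorm U l \<noteq> 0" using eq U by auto
    then obtain v where v: "v \<in> U" "l v \<noteq> 0" using fU by (auto simp: sqnorm_eq_0_iff)
    have evU: "eigvec U H 1 l" "eigvec U H 1 p"
      using ev p_ev U eigvec_blocks[of 1] by (auto simp: V_def)
    have "quad U H y \<le> 1 * sqnorm U y" for y
      using positive_eigvec_quad_le[of U H 1 p y] H_sym H_nonneg evU p_pos U by auto
    from maximizer_nonzero(2)[OF fU _ _ _ this evU(1) v]
    show ?thesis using U conn H_sym H_nonneg by auto
  qed
  have "(\<lambda>k. w (r k) a * w (r k) b) \<longlonglongrightarrow> l a * l b"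
    using l V by (intro tendsto_mult) auto
  then have "l a * l b = 0" by (simp add: st2 LIMSEQ_const_iff)
  then show False using nz[of V1] nz[of V2] ab by auto
qed

end

subsection \<open>Multiple singular values and the SSVP\<close>

text \<open>Two independent eigenvectors are completed to a basis, as columns \<open>p\<close> and
  \<open>q\<close> of \<open>S\<close>. The same columns of \<open>(x I - A) S\<close> are divisible
  by \<open>x - c\<close>, so \<open>(x - c)\<^sup>2\<close> divides \<open>char_poly A\<close>
  times the nonzero constant \<open>det S\<close>.\<close>

lemma order_char_poly_ge_2:
  fixes A :: "'a :: field mat"
  assumes A: "A \<in> carrier_mat n n"
    and eig: "\<And>i. i < n \<Longrightarrow> (\<Sum>j<n. A $$ (i, j) * u j) = c * u i"
      "\<And>i. i < n \<Longrightarrow> (\<Sum>j<n. A $$ (i, j) * u' j) = c * u' i"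
    and ind: "\<And>\<alpha> \<beta>. (\<And>i. i < n \<Longrightarrow> \<alpha> * u i + \<beta> * u' i = 0) \<Longrightarrow> \<alpha> = 0 \<and> \<beta> = 0"
  shows "2 \<le> order c (char_poly A)"
proof -
  obtain p where p: "p < n" "u p \<noteq> 0"
    using ind[of 1 0] by auto
  \<comment> \<open>One elimination step gives an eigenvector with \<open>v p = 0\<close>, which by
    independence is nonzero at some \<open>q\<close>. With unit vectors in the other columns,
    \<open>u\<close> and \<open>v\<close> then form an invertible matrix.\<close>
  define v where "v i = u' i - (u' p / u p) * u i" for i
  have vp: "v p = 0" using p by (simp add: v_def)
  have "\<exists>q<n. v q \<noteq> 0"
  proof (rule ccontr)
    assume *: "\<not> ?thesis"
    have "- (u' p / u p) * u i + 1 * u' i = 0" if "i < n" for i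
      using * that by (auto simp: v_def)
    then show False using ind[of "- (u' p / u p)" 1] by simp
  qed
  then obtain q where q: "q < n" "v q \<noteq> 0" by blast
  have pq: "p \<noteq> q" using vp q by auto
  have eigv: "(\<Sum>j<n. A $$ (i, j) * v j) = c * v i" if "i < n" for i
  proof -
    have "(\<Sum>j<n. A $$ (i, j) * v j) =
        (\<Sum>j<n. A $$ (i, j) * u' j) - (u' p / u p) * (\<Sum>j<n. A $$ (i, j) * u j)"
      unfolding v_def sum_distrib_left sum_subtractf[symmetric]
      by (intro sum.cong refl) (simp add: right_diff_distrib mult_ac)
    then show ?thesis using eig[OF that] by (simp add: v_def right_diff_distrib mult_ac)
  qed
  define S where "S = mat n n (\<lambda>(i, j). if j = p then u i else if j = q then v i else if i = j then 1 else 0)"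
  have S: "S \<in> carrier_mat n n" by (simp add: S_def)
  have detS: "det S \<noteq> 0"
  proof
    assume "det S = 0"
    then obtain x where x: "x \<in> carrier_vec n" "x \<noteq> 0\<^sub>v n" "S *\<^sub>v x = 0\<^sub>v n"
      using det_0_iff_vec_prod_zero[OF S] by auto
    have row: "(\<Sum>j<n. S $$ (i, j) * x $ j) = 0" if "i < n" for i
    proof -
      have "(S *\<^sub>v x) $ i = (\<Sum>j<n. S $$ (i, j) * x $ j)"
        using S x(1) that by (simp add: scalar_prod_def lessThan_atLeast0)
      then show ?thesis using x(3) that by simp
    qed
    have row': "u i * x $ p + v i * x $ q + (if i = p \<or> i = q then 0 else x $ i) = 0" if "i < n" for i
    proof -
      have "(\<Sum>j<n. S $$ (i, j) * x $ j) = (\<Sum>j<n. (if j = p then u i * x $ p else 0)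
          + (if j = q then v i * x $ q else 0) + (if j = i then (if i = p \<or> i = q then 0 else x $ i) else 0))"
        using that pq by (intro sum.cong) (auto simp: S_def)
      then show ?thesis using row[OF that] p q that by (simp add: sum.distrib)
    qed
    have xp: "x $ p = 0" using row'[OF p(1)] p vp by simp
    have xq: "x $ q = 0" using row'[OF q(1)] q xp by simp
    have "x $ i = 0" if "i < n" for i
      using row'[OF that] xp xq by (cases "i = p \<or> i = q") auto
    then show False using x(1,2) by (auto intro!: eq_vecI)
  qed
  let ?C = "char_poly_matrix A"
  define L where "L = map_mat (\<lambda>a. [:a:]) S"
  \<comment> \<open>Columns \<open>p\<close> and \<open>q\<close> of \<open>T\<close> keep only the
    constants from \<open>S\<close>; the two factors \<open>x - c\<close> split off from them go
    into \<open>D\<close>.\<close>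
  define T where "T = mat n n (\<lambda>(i, j). if j = p \<or> j = q then [:S $$ (i, j):] else (?C * L) $$ (i, j))"
  define D where "D = mat n n (\<lambda>(i, j). if i = j then (if j = p \<or> j = q then [:- c, 1:] else 1) else 0 :: 'a poly)"
  have carr: "?C \<in> carrier_mat n n" "L \<in> carrier_mat n n" "T \<in> carrier_mat n n" "D \<in> carrier_mat n n"
    using A S by (simp_all add: L_def T_def D_def)
  have CL: "(?C * L) $$ (i, j) = [:0, 1:] * [:S $$ (i, j):] - [:\<Sum>k<n. A $$ (i, k) * S $$ (k, j):]"
    if "i < n" "j < n" for i j
  proof -
    have "(?C * L) $$ (i, j) = (\<Sum>k<n. ?C $$ (i, k) * [:S $$ (k, j):])"
      using that carr S by (simp add: scalar_prod_def lessThan_atLeast0 L_def)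
    also have "\<dots> = (\<Sum>k<n. (if k = i then [:0, 1:] * [:S $$ (i, j):] else 0) - [:A $$ (i, k) * S $$ (k, j):])"
      using that A by (intro sum.cong) (auto simp: char_poly_matrix_def)
    also have "\<dots> = [:0, 1:] * [:S $$ (i, j):] - (\<Sum>k<n. [:A $$ (i, k) * S $$ (k, j):])"
      using that by (simp add: sum_subtractf)
    also have "(\<Sum>k<n. [:A $$ (i, k) * S $$ (k, j):]) = [:\<Sum>k<n. A $$ (i, k) * S $$ (k, j):]"
      by (induction n) auto
    finally show ?thesis .
  qed
  have fact: "?C * L = T * D"
  proof (rule eq_matI)
    fix i j assume "i < dim_row (T * D)" "j < dim_col (T * D)"
    then have ij: "i < n" "j < n" using carr by auto
    have "(T * D) $$ (i, j) = (\<Sum>k<n. T $$ (i, k) * D $$ (k, j))"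
      using ij carr by (simp add: scalar_prod_def lessThan_atLeast0)
    also have "\<dots> = (\<Sum>k<n. if k = j then T $$ (i, j) * D $$ (j, j) else 0)"
      using ij by (intro sum.cong) (auto simp: D_def)
    also have "\<dots> = T $$ (i, j) * D $$ (j, j)" using ij by simp
    also have "\<dots> = (?C * L) $$ (i, j)"
    proof (cases "j = p \<or> j = q")
      case True
      then have "(\<Sum>k<n. A $$ (i, k) * S $$ (k, j)) = c * S $$ (i, j)"
        using ij eig(1)[of i] eigv[of i] pq by (auto simp: S_def)
      then have "(?C * L) $$ (i, j) = [:0, 1:] * [:S $$ (i, j):] - [:c * S $$ (i, j):]"
        using CL[OF ij] by simp
      then show ?thesis using ij True by (simp add: T_def D_def mult.commute)
    next
      case False
      then show ?thesis using ij by (simp add: T_def D_def)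
    qed
    finally show "(?C * L) $$ (i, j) = (T * D) $$ (i, j)" by simp
  qed (use carr in auto)
  have "det D = prod_list (diag_mat D)"
    by (rule det_upper_triangular[OF _ carr(4)]) (auto simp: upper_triangular_def D_def)
  also have "\<dots> = (\<Prod>i\<in>{0..<n}. if i = p \<or> i = q then [:- c, 1:] else 1)"
    by (simp add: prod_list_diag_prod D_def)
  also have "\<dots> = (\<Prod>i\<in>{p, q}. [:- c, 1:])"
    using p q by (intro prod.mono_neutral_cong_right) auto
  also have "\<dots> = [:- c, 1:] ^ 2" using pq by (simp add: power2_eq_square)
  finally have detD: "det D = [:- c, 1:] ^ 2" .
  interpret lift: comm_ring_hom "\<lambda>a :: 'a. [:a:]"
    by unfold_locales (auto simp: one_pCons)
  have detL: "det L = [:det S:]"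
    unfolding L_def by (rule lift.hom_det)
  have prod: "char_poly A * [:det S:] = det T * [:- c, 1:] ^ 2"
    using arg_cong[OF fact, of det] carr by (simp add: det_mult char_poly_def detL detD)
  have "[:- c, 1:] ^ 2 dvd char_poly A * [:det S:]" unfolding prod by simp
  also have "char_poly A * [:det S:] = Polynomial.smult (det S) (char_poly A)" by simp
  finally have "[:- c, 1:] ^ 2 dvd char_poly A" using detS by (simp add: dvd_smult_iff)
  moreover have "char_poly A \<noteq> 0" using degree_monic_char_poly[OF A] by auto
  ultimately show ?thesis using order_divides[of c 2 "char_poly A"] by blast
qed

text \<open>The eigenvectors of \<open>bip M\<close> for \<open>t > 0\<close> are the pairs of left and right singular vectors
  of \<open>M\<close> for the singular value \<open>t\<close>.\<close>

definition bip :: "(nat \<Rightarrow> nat \<Rightarrow> real) \<Rightarrow> nat + nat \<Rightarrow> nat + nat \<Rightarrow> real" where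
  "bip M q r = (case (q, r) of (Inl i, Inr j) \<Rightarrow> M i j | (Inr j, Inl i) \<Rightarrow> M i j | _ \<Rightarrow> 0)"

lemma bip_simps [simp]:
  "bip M (Inl i) (Inr j) = M i j" "bip M (Inr j) (Inl i) = M i j"
  "bip M (Inl i) (Inl i') = 0" "bip M (Inr j) (Inr j') = 0"
  by (simp_all add: bip_def)

lemma bip_commute: "bip M q r = bip M r q"
  by (cases q; cases r) simp_all

definition verts_on :: "nat set \<Rightarrow> (nat + nat) set" where
  "verts_on R = Inl ` R \<union> Inr ` R"

lemma finite_verts_on [simp]: "finite R \<Longrightarrow> finite (verts_on R)"
  by (simp add: verts_on_def)

lemma verts_on_simps [simp]:
  "Inl i \<in> verts_on R \<longleftrightarrow> i \<in> R" "Inr i \<in> verts_on R \<longleftrightarrow> i \<in> R"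
  by (auto simp: verts_on_def)

lemma verts_on_cases:
  assumes "q \<in> verts_on R"
  obtains i where "q = Inl i" "i \<in> R" | i where "q = Inr i" "i \<in> R"
  using assms by (auto simp: verts_on_def)

lemma ball_verts_on:
  "(\<forall>q\<in>verts_on R. P q) \<longleftrightarrow> (\<forall>i\<in>R. P (Inl i)) \<and> (\<forall>i\<in>R. P (Inr i))"
  by (auto simp: verts_on_def)

lemma sum_verts_on:
  "finite R \<Longrightarrow> (\<Sum>q\<in>verts_on R. f q) = (\<Sum>i\<in>R. f (Inl i)) + (\<Sum>i\<in>R. f (Inr i))"
  unfolding verts_on_def by (subst sum.union_disjoint) (auto simp: sum.reindex)

lemma eigvec_bip_iff:
  assumes "finite R"
  shows "eigvec (verts_on R) (bip M) t w \<longleftrightarrow>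
    (\<forall>i\<in>R. (\<Sum>j\<in>R. M i j * w (Inr j)) = t * w (Inl i)) \<and>
    (\<forall>j\<in>R. (\<Sum>i\<in>R. M i j * w (Inl i)) = t * w (Inr j))"
  using assms by (simp add: eigvec_def sum_verts_on ball_verts_on)

text \<open>The row parts of \<open>w\<close> and \<open>w'\<close> are eigenvectors of
  \<open>M\<close> times its transpose for \<open>t\<^sup>2\<close>, so
  \<open>order_char_poly_ge_2\<close> applies.\<close>

lemma has_multiple_singular_valueI:
  assumes ev: "eigvec (verts_on {..<N}) (bip M) t w" "eigvec (verts_on {..<N}) (bip M) t w'"
    and ind: "independent_pair (verts_on {..<N}) w w'" and "t > 0"
  shows "has_multiple_singular_value (mat N N (\<lambda>(i, j). M i j))"
proof -
  let ?A = "mat N N (\<lambda>(i, j). M i j)"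
  let ?B = "?A * transpose_mat ?A"
  have B: "?B \<in> carrier_mat N N" by (rule carrier_matI) simp_all
  have eig: "(\<Sum>j<N. ?B $$ (i, j) * y (Inl j)) = t\<^sup>2 * y (Inl i)"
    if "i < N" and y: "eigvec (verts_on {..<N}) (bip M) t y" for i y
  proof -
    have 1: "(\<Sum>j<N. M i j * y (Inr j)) = t * y (Inl i)"
      using y that(1) by (simp add: eigvec_bip_iff)
    have 2: "(\<Sum>i<N. M i j * y (Inl i)) = t * y (Inr j)" if "j < N" for j
      using y that by (simp add: eigvec_bip_iff)
    have "(\<Sum>j<N. ?B $$ (i, j) * y (Inl j)) = (\<Sum>j<N. \<Sum>k<N. M i k * (M j k * y (Inl j)))"
      using that(1) by (intro sum.cong refl)
        (simp add: scalar_prod_def lessThan_atLeast0 sum_distrib_right mult.assoc)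
    also have "\<dots> = (\<Sum>k<N. M i k * (\<Sum>j<N. M j k * y (Inl j)))"
      by (subst sum.swap) (simp add: sum_distrib_left)
    also have "\<dots> = (\<Sum>k<N. t * (M i k * y (Inr k)))"
      using 2 by (intro sum.cong) (simp_all add: mult_ac)
    also have "\<dots> = t\<^sup>2 * y (Inl i)"
      using 1 by (simp add: power2_eq_square flip: sum_distrib_left)
    finally show ?thesis .
  qed
  have "2 \<le> order (t\<^sup>2) (char_poly ?B)"
  proof (rule order_char_poly_ge_2[OF B])
    show "(\<Sum>j<N. ?B $$ (i, j) * w (Inl j)) = t\<^sup>2 * w (Inl i)" if "i < N" for i
      using eig[OF that ev(1)] .
    show "(\<Sum>j<N. ?B $$ (i, j) * w' (Inl j)) = t\<^sup>2 * w' (Inl i)" if "i < N" for i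
      using eig[OF that ev(2)] .
    fix \<alpha> \<beta> assume *: "\<And>i. i < N \<Longrightarrow> \<alpha> * w (Inl i) + \<beta> * w' (Inl i) = 0"
    \<comment> \<open>As \<open>t > 0\<close>, the row parts determine the column parts linearly, so
      a relation between the row parts extends to all vertices.\<close>
    have **: "\<alpha> * w (Inr j) + \<beta> * w' (Inr j) = 0" if "j < N" for j
    proof -
      have "t * (\<alpha> * w (Inr j) + \<beta> * w' (Inr j)) =
          \<alpha> * (\<Sum>i<N. M i j * w (Inl i)) + \<beta> * (\<Sum>i<N. M i j * w' (Inl i))"
        using ev that by (simp add: eigvec_bip_iff distrib_left mult_ac)
      also have "\<dots> = (\<Sum>i<N. M i j * (\<alpha> * w (Inl i) + \<beta> * w' (Inl i)))"
        by (simp add: sum_distrib_left sum.distrib distrib_left mult_ac)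
      also have "\<dots> = 0" using * by simp
      finally show ?thesis using \<open>t > 0\<close> by simp
    qed
    have "\<forall>q\<in>verts_on {..<N}. \<alpha> * w q + \<beta> * w' q = 0"
      unfolding ball_verts_on using * ** by blast
    then show "\<alpha> = 0 \<and> \<beta> = 0"
      using ind unfolding independent_pair_def by blast
  qed
  moreover have "char_poly ?B \<noteq> 0" using degree_monic_char_poly[OF B] by auto
  ultimately have 2: "2 \<le> count (proots (char_poly ?B)) (t\<^sup>2)" by simp
  then have "t\<^sup>2 \<in># proots (char_poly ?B)"
    by (metis count_inI not_numeral_le_zero)
  \<comment> \<open>Taking square roots may merge elements of the multiset but loses no
    multiplicity.\<close>
  then have "count (proots (char_poly ?B)) (t\<^sup>2) \<le> count (singular_values ?A) (sqrt (t\<^sup>2))"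
    unfolding singular_values_def count_image_mset' by (intro member_le_sum) simp_all
  with 2 have "2 \<le> count (singular_values ?A) (sqrt (t\<^sup>2))" by linarith
  then show ?thesis unfolding has_multiple_singular_value_def by blast
qed

section \<open>The SSVP as a linear system and its stability under limits\<close>

text \<open>Symmetry of \<open>A\<^sup>T * X\<close> and \<open>X * A\<^sup>T\<close> in
  coordinates, with matrices given as functions so that limits can be taken entry by entry.\<close>

definition sym_products :: "nat \<Rightarrow> (nat \<Rightarrow> nat \<Rightarrow> real) \<Rightarrow> (nat \<Rightarrow> nat \<Rightarrow> real) \<Rightarrow> bool" where
  "sym_products N M X \<longleftrightarrow>
    (\<forall>j<N. \<forall>k<N. (\<Sum>i<N. M i j * X i k) = (\<Sum>i<N. M i k * X i j)) \<and>
    (\<forall>i<N. \<forall>l<N. (\<Sum>j<N. X i j * M l j) = (\<Sum>j<N. X l j * M i j))"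

lemma SSVP_mat_iff:
  "SSVP (mat N N (\<lambda>(i, j). M i j)) \<longleftrightarrow>
    (\<forall>X. sym_products N M X \<and> (\<forall>i<N. \<forall>j<N. M i j \<noteq> 0 \<longrightarrow> X i j = 0) \<longrightarrow>
      (\<forall>i<N. \<forall>j<N. X i j = 0))" (is "SSVP ?A \<longleftrightarrow> ?R")
proof -
  have conv: "symmetric_mat (transpose_mat ?A * X) \<and> symmetric_mat (X * transpose_mat ?A) \<and>
      entrywise_prod ?A X = 0\<^sub>m N N \<longleftrightarrow>
      sym_products N M (\<lambda>i j. X $$ (i, j)) \<and> (\<forall>i<N. \<forall>j<N. M i j \<noteq> 0 \<longrightarrow> X $$ (i, j) = 0)"
    if X: "X \<in> carrier_mat N N" for X
  proof -
    have sym: "symmetric_mat B \<longleftrightarrow> (\<forall>i<N. \<forall>j<N. B $$ (i, j) = B $$ (j, i))"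
      if "B \<in> carrier_mat N N" for B :: "real mat"
    proof
      assume "symmetric_mat B"
      then have "transpose_mat B = B" by (simp add: symmetric_mat_def)
      then show "\<forall>i<N. \<forall>j<N. B $$ (i, j) = B $$ (j, i)"
        using that by (metis carrier_matD index_transpose_mat(1))
    next
      assume "\<forall>i<N. \<forall>j<N. B $$ (i, j) = B $$ (j, i)"
      then show "symmetric_mat B"
        unfolding symmetric_mat_def using that by (intro eq_matI) auto
    qed
    have 1: "(transpose_mat ?A * X) $$ (j, k) = (\<Sum>i<N. M i j * X $$ (i, k))" if "j < N" "k < N" for j k
      using that X by (simp add: scalar_prod_def lessThan_atLeast0)
    have 2: "(X * transpose_mat ?A) $$ (i, l) = (\<Sum>j<N. X $$ (i, j) * M l j)" if "i < N" "l < N" for i l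
      using that X by (simp add: scalar_prod_def lessThan_atLeast0)
    have 3: "entrywise_prod ?A X = 0\<^sub>m N N \<longleftrightarrow> (\<forall>i<N. \<forall>j<N. M i j \<noteq> 0 \<longrightarrow> X $$ (i, j) = 0)"
      unfolding entrywise_prod_def using X by (auto simp: mat_eq_iff)
    have "transpose_mat ?A * X \<in> carrier_mat N N" "X * transpose_mat ?A \<in> carrier_mat N N"
      using X by auto
    then show ?thesis
      unfolding sym[OF \<open>transpose_mat ?A * X \<in> carrier_mat N N\<close>]
        sym[OF \<open>X * transpose_mat ?A \<in> carrier_mat N N\<close>] 3 sym_products_def
      by (auto simp: 1 2)
  qed
  show ?thesis
  proof
    assume S: "SSVP ?A"
    show ?R
    proof (intro allI impI)
      fix X i j
      assume X: "sym_products N M X \<and> (\<forall>i<N. \<forall>j<N. M i j \<noteq> 0 \<longrightarrow> X i j = 0)" and ij: "i < N" "j < N"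
      let ?X = "mat N N (\<lambda>(i, j). X i j)"
      have "sym_products N M (\<lambda>i j. ?X $$ (i, j))"
        using X by (simp add: sym_products_def cong: sum.cong_simp)
      then have "?X = 0\<^sub>m N N"
        using S X conv[of ?X] by (auto simp: SSVP_def)
      then have "?X $$ (i, j) = 0" using ij by simp
      then show "X i j = 0" using ij by simp
    qed
  next
    assume R: ?R
    show "SSVP ?A"
      unfolding SSVP_def
    proof (intro ballI impI)
      fix X assume X: "X \<in> carrier_mat (dim_row ?A) (dim_col ?A)"
        and s: "symmetric_mat (transpose_mat ?A * X) \<and> symmetric_mat (X * transpose_mat ?A) \<and>
          entrywise_prod ?A X = 0\<^sub>m (dim_row ?A) (dim_col ?A)"
      then show "X = 0\<^sub>m (dim_row ?A) (dim_col ?A)"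
        using R conv[of X] by (intro eq_matI) auto
    qed
  qed
qed

text \<open>Openness of having only the trivial solution, in contrapositive form: nonzero solutions
  are scaled to norm 1, and a limit point of them is a nonzero solution for the limit matrix. The
  set \<open>Z\<close> of prescribed zeros does not vary with \<open>k\<close> and may be larger
  than the pattern of \<open>M'\<close>.\<close>

lemma sym_products_limit:
  fixes M :: "nat \<Rightarrow> nat \<Rightarrow> nat \<Rightarrow> real"
  assumes lim: "\<And>i j. i < N \<Longrightarrow> j < N \<Longrightarrow> (\<lambda>k. M k i j) \<longlonglongrightarrow> M' i j"
    and ex: "\<And>k. \<exists>X. sym_products N (M k) X \<and> (\<forall>(i, j)\<in>Z. X i j = 0) \<and> (\<exists>i<N. \<exists>j<N. X i j \<noteq> 0)"
    and Z: "Z \<subseteq> {..<N} \<times> {..<N}"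
  shows "\<exists>X. sym_products N M' X \<and> (\<forall>(i, j)\<in>Z. X i j = 0) \<and> (\<exists>i<N. \<exists>j<N. X i j \<noteq> 0)"
proof -
  let ?T = "{..<N} \<times> {..<N}"
  have "\<exists>Y. sym_products N (M k) Y \<and> (\<forall>(i, j)\<in>Z. Y i j = 0) \<and> sqnorm ?T (\<lambda>(i, j). Y i j) = 1" for k
  proof -
    obtain X i j where X: "sym_products N (M k) X" "\<forall>(i, j)\<in>Z. X i j = 0" "i < N" "j < N" "X i j \<noteq> 0"
      using ex by blast
    obtain c where c: "c > 0" "sqnorm ?T (\<lambda>z. c * (case z of (i, j) \<Rightarrow> X i j)) = 1"
      using normalize_sqnorm[of ?T "(i, j)" "\<lambda>(i, j). X i j"] X by auto
    have "sym_products N (M k) (\<lambda>i j. c * X i j)"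
      using X(1) by (simp add: sym_products_def mult.left_commute[of _ c] mult.assoc[of c] flip: sum_distrib_left)
    then show ?thesis
      using X(2) c(2) by (intro exI[of _ "\<lambda>i j. c * X i j"]) (auto simp: split_def)
  qed
  then obtain Y where Y: "\<And>k. sym_products N (M k) (Y k)" "\<And>k. \<forall>(i, j)\<in>Z. Y k i j = 0"
    and Y1: "\<And>k. sqnorm ?T (\<lambda>(i, j). Y k i j) = 1" by metis
  obtain r l where r: "strict_mono (r :: nat \<Rightarrow> nat)"
    and l: "\<And>z. z \<in> ?T \<Longrightarrow> (\<lambda>k. (\<lambda>(i, j). Y (r k) i j) z) \<longlonglongrightarrow> l z"
    using pointwise_convergent_subseq[of ?T "\<lambda>k (i, j). Y k i j" 1] abs_le_1_if_sqnorm_1[OF _ Y1]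
    by blast
  define X where "X i j = l (i, j)" for i j
  have Xl: "(\<lambda>k. Y (r k) i j) \<longlonglongrightarrow> X i j" if "i < N" "j < N" for i j
    using l[of "(i, j)"] that by (simp add: X_def)
  have Ml: "(\<lambda>k. M (r k) i j) \<longlonglongrightarrow> M' i j" if "i < N" "j < N" for i j
    using LIMSEQ_subseq_LIMSEQ[OF lim[OF that] r] by (simp add: o_def)
  have "sym_products N M' X"
    unfolding sym_products_def
  proof (intro conjI allI impI)
    fix j k assume jk: "j < N" "k < N"
    have "(\<lambda>n. \<Sum>i<N. M (r n) i j * Y (r n) i k) \<longlonglongrightarrow> (\<Sum>i<N. M' i j * X i k)"
      using Xl Ml jk by (intro tendsto_intros) auto
    moreover have "(\<lambda>n. \<Sum>i<N. M (r n) i k * Y (r n) i j) \<longlonglongrightarrow> (\<Sum>i<N. M' i k * X i j)"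
      using Xl Ml jk by (intro tendsto_intros) auto
    moreover have "(\<Sum>i<N. M (r n) i j * Y (r n) i k) = (\<Sum>i<N. M (r n) i k * Y (r n) i j)" for n
      using Y(1)[of "r n"] jk by (simp add: sym_products_def)
    ultimately show "(\<Sum>i<N. M' i j * X i k) = (\<Sum>i<N. M' i k * X i j)"
      using LIMSEQ_unique by simp
  next
    fix i k assume ik: "i < N" "k < N"
    have "(\<lambda>n. \<Sum>j<N. Y (r n) i j * M (r n) k j) \<longlonglongrightarrow> (\<Sum>j<N. X i j * M' k j)"
      using Xl Ml ik by (intro tendsto_intros) auto
    moreover have "(\<lambda>n. \<Sum>j<N. Y (r n) k j * M (r n) i j) \<longlonglongrightarrow> (\<Sum>j<N. X k j * M' i j)"
      using Xl Ml ik by (intro tendsto_intros) auto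
    moreover have "(\<Sum>j<N. Y (r n) i j * M (r n) k j) = (\<Sum>j<N. Y (r n) k j * M (r n) i j)" for n
      using Y(1)[of "r n"] ik by (simp add: sym_products_def)
    ultimately show "(\<Sum>j<N. X i j * M' k j) = (\<Sum>j<N. X k j * M' i j)"
      using LIMSEQ_unique by simp
  qed
  moreover have "X i j = 0" if "(i, j) \<in> Z" for i j
  proof -
    have "i < N" "j < N" using Z that by auto
    moreover have "Y (r k) i j = 0" for k using Y(2)[of "r k"] that by blast
    ultimately show ?thesis using Xl[of i j] by (simp add: LIMSEQ_const_iff)
  qed
  moreover have "\<exists>i<N. \<exists>j<N. X i j \<noteq> 0"
  proof -
    have "sqnorm ?T l = 1" using sqnorm_1_limit[of ?T "\<lambda>k (i, j). Y (r k) i j" l] Y1 l by auto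
    then have "\<not> (\<forall>z\<in>?T. l z = 0)" using sqnorm_eq_0_iff[of ?T l] by simp
    then show ?thesis by (auto simp: X_def)
  qed
  ultimately show ?thesis by (intro exI[of _ X]) auto
qed

subsection \<open>Block diagonal matrices with one common singular value\<close>

lemma maxev_positive_eigvec:
  assumes V: "finite V" "V \<noteq> {}" and sym: "\<And>a b. a \<in> V \<Longrightarrow> b \<in> V \<Longrightarrow> H a b = H b a"
    and nonneg: "\<And>a b. a \<in> V \<Longrightarrow> b \<in> V \<Longrightarrow> 0 \<le> H a b" and conn: "graph_connected V H"
  obtains p where "\<And>a. a \<in> V \<Longrightarrow> p a > 0" and "eigvec V H (maxev V H) p"
proof -
  obtain w where w: "sqnorm V w = 1" "quad V H w = maxev V H"
    using ex_maximizer[OF V] by metis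
  have le: "quad V H y \<le> maxev V H * sqnorm V y" for y by (rule quad_le_maxev[OF V])
  have ev: "eigvec V H (maxev V H) w"
    using w le sym V by (intro maximizer_eigvec) auto
  have "\<not> (\<forall>v\<in>V. w v = 0)" using w(1) V(1) by (metis sqnorm_eq_0_iff zero_neq_one)
  then obtain v where v: "v \<in> V" "w v \<noteq> 0" by blast
  from maximizer_nonzero[OF V(1) sym nonneg conn le ev v]
  show ?thesis using that[of "\<lambda>a. \<bar>w a\<bar>"] by auto
qed

text \<open>The eigenvector equation is read at a vertex where the positive eigenvector is
  largest.\<close>

lemma maxev_le_row_sum:
  assumes V: "finite V" "V \<noteq> {}" and sym: "\<And>a b. a \<in> V \<Longrightarrow> b \<in> V \<Longrightarrow> H a b = H b a"
    and nonneg: "\<And>a b. a \<in> V \<Longrightarrow> b \<in> V \<Longrightarrow> 0 \<le> H a b" and conn: "graph_connected V H"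
    and row: "\<And>a. a \<in> V \<Longrightarrow> (\<Sum>b\<in>V. H a b) \<le> c"
  shows "maxev V H \<le> c"
proof -
  obtain p where p: "\<And>a. a \<in> V \<Longrightarrow> p a > 0" and ev: "eigvec V H (maxev V H) p"
    using maxev_positive_eigvec[OF V sym nonneg conn] by blast
  obtain a where a: "a \<in> V" "\<And>b. b \<in> V \<Longrightarrow> p b \<le> p a"
  proof -
    have "Max (p ` V) \<in> p ` V" using V by (intro Max_in) auto
    then obtain a where "a \<in> V" "p a = Max (p ` V)" by auto
    then show ?thesis using that[of a] V by auto
  qed
  have "maxev V H * p a = (\<Sum>b\<in>V. H a b * p b)" using ev a by (simp add: eigvec_def)
  also have "\<dots> \<le> (\<Sum>b\<in>V. H a b * p a)"
    using a nonneg by (intro sum_mono mult_left_mono) auto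
  also have "\<dots> \<le> c * p a"
    using row[OF a(1)] p[OF a(1)] by (simp add: mult_right_mono flip: sum_distrib_right)
  finally show ?thesis using p[OF a(1)] by simp
qed

lemma graph_connected_cong:
  assumes "graph_connected V H" and "\<And>q r. q \<in> V \<Longrightarrow> r \<in> V \<Longrightarrow> H' q r \<noteq> 0 \<longleftrightarrow> H q r \<noteq> 0"
  shows "graph_connected V H'"
  using assms unfolding graph_connected_def by (metis (no_types, lifting))

lemma bip_nonzero_iff: "(\<And>i j. M i j \<noteq> 0 \<longleftrightarrow> B i j) \<Longrightarrow>
  bip M q r \<noteq> 0 \<longleftrightarrow> bip (\<lambda>i j. of_bool (B i j)) q r \<noteq> 0"
  by (cases q; cases r) auto

section \<open>Block diagonal patterns with a transversal\<close>

text \<open>\<open>B\<close> is the pattern of the direct sum of \<open>P\<close> and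
  \<open>Q\<close>, the indices below \<open>m\<close> belonging to \<open>P\<close>.
  \<open>\<pi>\<close> is a transversal that respects the blocks, as full term-rank
  provides.\<close>

locale block_pattern =
  fixes m n :: nat and \<pi> :: "nat \<Rightarrow> nat" and B :: "nat \<Rightarrow> nat \<Rightarrow> bool"
  assumes mn: "m > 0" "n > 0"
    and \<pi>: "bij_betw \<pi> {..<m} {..<m}" "bij_betw \<pi> {m..<m + n} {m..<m + n}"
    and B_\<pi>: "\<And>i. i < m + n \<Longrightarrow> B i (\<pi> i)"
    and B_block: "\<And>i j. B i j \<Longrightarrow> i < m + n \<and> j < m + n \<and> (i < m \<longleftrightarrow> j < m)"
    and conn: "graph_connected (verts_on {..<m}) (bip (\<lambda>i j. of_bool (B i j)))"
      "graph_connected (verts_on {m..<m + n}) (bip (\<lambda>i j. of_bool (B i j)))"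
begin

text \<open>The weights on the transversal \<open>\<pi>\<close> are pairwise distinct, except that each block has
  largest weight 1.\<close>

definition "wt i = (if i = 0 \<or> i = m then 1 else 1 / (1 + real i))"

definition "base \<delta> i j = (if B i j then if j = \<pi> i then wt i else \<delta> else 0)"

definition "block i = (if i < m then {..<m} else {m..<m + n})"

text \<open>The largest singular value of the block that contains \<open>i\<close>, as the largest
  eigenvalue of its bipartite matrix.\<close>

definition "scale \<delta> i = maxev (verts_on (block i)) (bip (base \<delta>))"

text \<open>Both diagonal blocks are normalized to have largest singular value 1.\<close>

definition "normed \<delta> i j = base \<delta> i j / scale \<delta> i"

lemma wt_bounds: "0 < wt i" "wt i \<le> 1"
  by (simp_all add: wt_def)

text \<open>The only coincidence, between \<open>0\<close> and \<open>m\<close>, is the singular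
  value that the two blocks share.\<close>

lemma wt_eq_iff: "wt i = wt j \<longleftrightarrow> i = j \<or> {i, j} = {0, m}"
  using mn by (auto simp: wt_def divide_simps doubleton_eq_iff)

lemma \<pi>_less: "i < m + n \<Longrightarrow> \<pi> i < m + n" "i < m + n \<Longrightarrow> \<pi> i < m \<longleftrightarrow> i < m"
  using B_block[OF B_\<pi>[of i]] by simp_all

lemma \<pi>_inj: "i < m + n \<Longrightarrow> j < m + n \<Longrightarrow> \<pi> i = \<pi> j \<longleftrightarrow> i = j"
proof
  assume ij: "i < m + n" "j < m + n" and eq: "\<pi> i = \<pi> j"
  then have "i < m \<longleftrightarrow> j < m" using \<pi>_less(2)[of i] \<pi>_less(2)[of j] by simp
  then have "i \<in> {..<m} \<and> j \<in> {..<m} \<or> i \<in> {m..<m + n} \<and> j \<in> {m..<m + n}" using ij by auto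
  then show "i = j"
    using inj_onD[OF bij_betw_imp_inj_on[OF \<pi>(1)] eq] inj_onD[OF bij_betw_imp_inj_on[OF \<pi>(2)] eq] by blast
qed simp

lemma \<pi>_surj: "j < m + n \<Longrightarrow> \<exists>i<m + n. \<pi> i = j"
proof -
  assume j: "j < m + n"
  have "{..<m + n} = {..<m} \<union> {m..<m + n}" by auto
  then have "\<pi> ` {..<m + n} = {..<m + n}"
    using \<pi> by (simp add: bij_betw_def image_Un)
  then show ?thesis using j by (metis imageE lessThan_iff)
qed

lemma block: "finite (block i)" "block i \<noteq> {}"
  "i < m + n \<Longrightarrow> i \<in> block i" "j \<in> block i \<Longrightarrow> j < m + n" "j \<in> block i \<Longrightarrow> block j = block i"
  using mn by (auto simp: block_def split: if_splits)

lemma mem_block: "i < m + n \<Longrightarrow> j \<in> block i \<longleftrightarrow> j < m + n \<and> (i < m \<longleftrightarrow> j < m)"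
  by (auto simp: block_def)

lemma verts_block: "finite (verts_on (block i))" "verts_on (block i) \<noteq> {}"
  using block(1,2)[of i] by (auto simp: verts_on_def)

lemma base_nonneg: "\<delta> > 0 \<Longrightarrow> 0 \<le> base \<delta> i j"
  using wt_bounds less_imp_le by (auto simp: base_def)

lemma bip_base_nonneg: "\<delta> > 0 \<Longrightarrow> 0 \<le> bip (base \<delta>) q r"
  using base_nonneg by (cases q; cases r) auto

lemma base_nonzero_iff: "\<delta> > 0 \<Longrightarrow> base \<delta> i j \<noteq> 0 \<longleftrightarrow> B i j"
  using wt_bounds[of i] by (auto simp: base_def)

lemma conn_base:
  assumes "\<delta> > 0"
  shows "graph_connected (verts_on (block i)) (bip (base \<delta>))"
proof -
  have "graph_connected (verts_on (block i)) (bip (\<lambda>i j. of_bool (B i j)))"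
    using conn by (simp add: block_def)
  then show ?thesis
    by (rule graph_connected_cong) (rule bip_nonzero_iff[OF base_nonzero_iff[OF assms]])
qed

lemma scale_eigvec:
  assumes "\<delta> > 0"
  obtains p where "\<And>a. a \<in> verts_on (block i) \<Longrightarrow> p a > 0"
    and "eigvec (verts_on (block i)) (bip (base \<delta>)) (scale \<delta> i) p"
  using maxev_positive_eigvec[OF verts_block bip_commute bip_base_nonneg[OF assms] conn_base[OF assms]]
  unfolding scale_def by blast

text \<open>The transversal entry in row \<open>i\<close> is 1, so each of the positive values of
  \<open>p\<close> at its two ends is at most the eigenvalue times the other; the two inequalities
  are added.\<close>

lemma scale_root_ge_1:
  assumes \<delta>: "\<delta> > 0" and i: "i = 0 \<or> i = m"
  shows "scale \<delta> i \<ge> 1"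
proof -
  let ?V = "verts_on (block i)" and ?s = "scale \<delta> i"
  obtain p where p: "\<And>a. a \<in> ?V \<Longrightarrow> p a > 0" and ev: "eigvec ?V (bip (base \<delta>)) ?s p"
    using scale_eigvec[OF \<delta>] by blast
  have iN: "i < m + n" using i mn by auto
  have mem: "i \<in> block i" "\<pi> i \<in> block i" using iN \<pi>_less by (auto simp: mem_block)
  have p0: "0 \<le> p a" if "a \<in> ?V" for a using p[OF that] by simp
  have b1: "base \<delta> i (\<pi> i) = 1" using B_\<pi>[OF iN] i by (auto simp: base_def wt_def)
  have "p (Inr (\<pi> i)) = base \<delta> i (\<pi> i) * p (Inr (\<pi> i))" by (simp add: b1)
  also have "\<dots> \<le> (\<Sum>j\<in>block i. base \<delta> i j * p (Inr j))"
    using mem block(1) base_nonneg[OF \<delta>] p0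
    by (intro member_le_sum) (auto intro!: mult_nonneg_nonneg)
  also have "\<dots> = ?s * p (Inl i)" using ev mem block(1) by (simp add: eigvec_bip_iff)
  finally have 1: "p (Inr (\<pi> i)) \<le> ?s * p (Inl i)" .
  have "p (Inl i) = base \<delta> i (\<pi> i) * p (Inl i)" by (simp add: b1)
  also have "\<dots> \<le> (\<Sum>j\<in>block i. base \<delta> j (\<pi> i) * p (Inl j))"
    using mem block(1) base_nonneg[OF \<delta>] p0
    by (intro member_le_sum[of i _ "\<lambda>j. base \<delta> j (\<pi> i) * p (Inl j)"])
      (auto intro!: mult_nonneg_nonneg)
  also have "\<dots> = ?s * p (Inr (\<pi> i))" using ev mem block(1) by (simp add: eigvec_bip_iff)
  finally have 2: "p (Inl i) \<le> ?s * p (Inr (\<pi> i))" .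
  have pos: "p (Inl i) > 0" "p (Inr (\<pi> i)) > 0" using p mem by auto
  have "(p (Inl i) + p (Inr (\<pi> i))) * 1 \<le> (p (Inl i) + p (Inr (\<pi> i))) * ?s"
    using 1 2 by (simp add: algebra_simps)
  then show ?thesis using pos by (subst (asm) mult_le_cancel_left_pos) auto
qed

text \<open>Each row and column of a block holds one transversal entry, at most 1, and otherwise
  entries at most \<open>\<delta>\<close>. The row sums of the bipartite matrix cover both.\<close>

lemma scale_le:
  assumes \<delta>: "\<delta> > 0"
  shows "scale \<delta> i \<le> 1 + \<delta> * real (m + n)"
  unfolding scale_def
proof (rule maxev_le_row_sum[OF verts_block bip_commute bip_base_nonneg[OF \<delta>] conn_base[OF \<delta>]])
  fix q assume q: "q \<in> verts_on (block i)"
  have card: "card (block i) \<le> m + n" by (simp add: block_def)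
  have bound: "(\<Sum>j\<in>block i. f j) \<le> 1 + \<delta> * real (m + n)"
    if "\<And>j. j \<in> block i \<Longrightarrow> f j \<le> (if j = a then 1 else 0) + \<delta>" for f a
  proof -
    have "(\<Sum>j\<in>block i. f j) \<le> (\<Sum>j\<in>block i. (if j = a then 1 else 0) + \<delta>)"
      using that by (intro sum_mono) auto
    also have "\<dots> \<le> 1 + \<delta> * real (card (block i))"
      using block(1) by (simp add: sum.distrib mult.commute)
    also have "\<dots> \<le> 1 + \<delta> * real (m + n)"
      using \<delta> card by (intro add_left_mono mult_left_mono) linarith+
    finally show ?thesis .
  qed
  show "(\<Sum>r\<in>verts_on (block i). bip (base \<delta>) q r) \<le> 1 + \<delta> * real (m + n)"
    using q
  proof (cases rule: verts_on_cases)
    case (1 k)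
    have "base \<delta> k j \<le> (if j = \<pi> k then 1 else 0) + \<delta>" for j
      using \<delta> wt_bounds(2)[of k] by (auto simp: base_def)
    from bound[of "base \<delta> k", OF this] show ?thesis
      using 1 block(1) by (simp add: sum_verts_on)
  next
    case (2 k)
    then obtain k' where k': "k' < m + n" "\<pi> k' = k" using \<pi>_surj block(4) by blast
    have "base \<delta> j k \<le> (if j = k' then 1 else 0) + \<delta>" if "j \<in> block i" for j
      using \<delta> wt_bounds(2)[of j] k' \<pi>_inj[OF k'(1), of j] block(4)[OF that] by (auto simp: base_def)
    from bound[of "\<lambda>j. base \<delta> j k", OF this] show ?thesis
      using 2 block(1) by (simp add: sum_verts_on)
  qed
qed

lemma scale_ge_1:
  assumes "\<delta> > 0"
  shows "scale \<delta> i \<ge> 1"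
proof -
  have "scale \<delta> i = scale \<delta> (if i < m then 0 else m)" using mn by (simp add: scale_def block_def)
  then show ?thesis using scale_root_ge_1[OF assms] by auto
qed

lemma normed_nonneg: "\<delta> > 0 \<Longrightarrow> 0 \<le> normed \<delta> i j"
  using base_nonneg[of \<delta> i j] scale_ge_1[of \<delta> i] by (simp add: normed_def)

lemma normed_nonzero_iff: "\<delta> > 0 \<Longrightarrow> normed \<delta> i j \<noteq> 0 \<longleftrightarrow> B i j"
  using base_nonzero_iff[of \<delta> i j] scale_ge_1[of \<delta> i] by (simp add: normed_def)

lemma conn_normed:
  assumes "\<delta> > 0"
  shows "graph_connected (verts_on {..<m}) (bip (normed \<delta>))"
    and "graph_connected (verts_on {m..<m + n}) (bip (normed \<delta>))"
  by (rule graph_connected_cong[OF conn(1)], rule bip_nonzero_iff[OF normed_nonzero_iff[OF assms]])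
    (rule graph_connected_cong[OF conn(2)], rule bip_nonzero_iff[OF normed_nonzero_iff[OF assms]])

lemma sum_block:
  assumes "i < m + n" and "\<And>j. j < m + n \<Longrightarrow> (i < m) \<noteq> (j < m) \<Longrightarrow> f j = 0"
  shows "(\<Sum>j<m + n. f j) = (\<Sum>j\<in>block i. f j)"
  using assms block(4) by (intro sum.mono_neutral_right) (auto simp: mem_block)

text \<open>The Perron vectors of the two uncoupled blocks are glued together, and dividing by
  \<open>scale\<close> turns both eigenvalues into 1.\<close>

lemma normed_eigvec:
  assumes \<delta>: "\<delta> > 0"
  obtains p where "\<And>a. a \<in> verts_on {..<m + n} \<Longrightarrow> p a > 0"
    and "eigvec (verts_on {..<m + n}) (bip (normed \<delta>)) 1 p"
proof -
  obtain p1 where p1: "\<And>a. a \<in> verts_on (block 0) \<Longrightarrow> p1 a > 0"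
    and ev1: "eigvec (verts_on (block 0)) (bip (base \<delta>)) (scale \<delta> 0) p1"
    using scale_eigvec[OF \<delta>] by blast
  obtain p2 where p2: "\<And>a. a \<in> verts_on (block m) \<Longrightarrow> p2 a > 0"
    and ev2: "eigvec (verts_on (block m)) (bip (base \<delta>)) (scale \<delta> m) p2"
    using scale_eigvec[OF \<delta>] by blast
  define p where "p q = (if q \<in> verts_on {..<m} then p1 q else p2 q)" for q
  have bl: "block i = block (if i < m then 0 else m)" for i using mn by (simp add: block_def)
  have sc: "scale \<delta> i = scale \<delta> (if i < m then 0 else m)" for i using bl[of i] by (simp add: scale_def)
  have pos: "p a > 0" if "a \<in> verts_on {..<m + n}" for a
    using p1[of a] p2[of a] that mn by (auto simp: p_def block_def elim!: verts_on_cases split: if_splits)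
  have evp: "eigvec (verts_on (block i)) (bip (base \<delta>)) (scale \<delta> i) p" for i
  proof (cases "i < m")
    case True
    then have "eigvec (verts_on (block i)) (bip (base \<delta>)) (scale \<delta> i) p1"
      using ev1 bl[of i] sc[of i] by simp
    moreover have "p a = p1 a" if "a \<in> verts_on (block i)" for a
      using that True by (auto simp: p_def block_def)
    ultimately show ?thesis by (simp add: eigvec_def)
  next
    case False
    then have "eigvec (verts_on (block i)) (bip (base \<delta>)) (scale \<delta> i) p2"
      using ev2 bl[of i] sc[of i] by simp
    moreover have "p a = p2 a" if "a \<in> verts_on (block i)" for a
      using that False by (auto simp: p_def block_def elim!: verts_on_cases)
    ultimately show ?thesis by (simp add: eigvec_def)
  qed
  have "eigvec (verts_on {..<m + n}) (bip (normed \<delta>)) 1 p"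
    unfolding eigvec_bip_iff[OF finite_lessThan]
  proof (intro conjI ballI)
    fix i assume "i \<in> {..<m + n}"
    then have i: "i < m + n" by simp
    have s: "scale \<delta> i \<noteq> 0" using scale_ge_1[OF \<delta>, of i] by auto
    have "(\<Sum>j<m + n. normed \<delta> i j * p (Inr j)) = (\<Sum>j\<in>block i. normed \<delta> i j * p (Inr j))"
      using B_block by (intro sum_block[OF i]) (auto simp: normed_def base_def)
    also have "\<dots> = (\<Sum>j\<in>block i. base \<delta> i j * p (Inr j)) / scale \<delta> i"
      by (simp add: normed_def sum_divide_distrib)
    also have "(\<Sum>j\<in>block i. base \<delta> i j * p (Inr j)) = scale \<delta> i * p (Inl i)"
      using evp[of i] block(1,3) i by (simp add: eigvec_bip_iff)
    finally show "(\<Sum>j<m + n. normed \<delta> i j * p (Inr j)) = 1 * p (Inl i)" using s by simp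
    have "(\<Sum>j<m + n. normed \<delta> j i * p (Inl j)) = (\<Sum>j\<in>block i. normed \<delta> j i * p (Inl j))"
      using B_block by (intro sum_block[OF i]) (auto simp: normed_def base_def)
    \<comment> \<open>All rows of one block have the same scale, so it can be factored out of a
      column sum as well.\<close>
    also have "\<dots> = (\<Sum>j\<in>block i. base \<delta> j i * p (Inl j) / scale \<delta> i)"
      using block(5)[of _ i] by (intro sum.cong refl) (simp add: normed_def scale_def)
    also have "\<dots> = (\<Sum>j\<in>block i. base \<delta> j i * p (Inl j)) / scale \<delta> i"
      by (simp add: sum_divide_distrib)
    also have "(\<Sum>j\<in>block i. base \<delta> j i * p (Inl j)) = scale \<delta> i * p (Inr i)"
      using evp[of i] block(1,3) i by (simp add: eigvec_bip_iff)
    finally show "(\<Sum>j<m + n. normed \<delta> j i * p (Inl j)) = 1 * p (Inr i)" using s by simp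
  qed
  with pos that show ?thesis by blast
qed

definition "diag i j = (if i < m + n \<and> j = \<pi> i then wt i else 0)"

lemma normed_tendsto:
  assumes d0: "d \<longlonglongrightarrow> 0" and d: "\<And>k. d k > 0"
  shows "(\<lambda>k. normed (d k) i j) \<longlonglongrightarrow> diag i j"
proof -
  have "(\<lambda>k. 1 + d k * real (m + n)) \<longlonglongrightarrow> 1 + 0 * real (m + n)"
    using d0 by (intro tendsto_intros)
  then have upper: "(\<lambda>k. 1 + d k * real (m + n)) \<longlonglongrightarrow> 1" by simp
  have "(\<lambda>k. scale (d k) i) \<longlonglongrightarrow> 1"
    by (rule tendsto_sandwich[OF _ _ tendsto_const upper])
      (auto intro!: always_eventually scale_ge_1[OF d] scale_le[OF d] simp del: of_nat_add)
  moreover have "(\<lambda>k. base (d k) i j) \<longlonglongrightarrow> diag i j"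
  proof (cases "B i j")
    case True
    then show ?thesis using d0 B_block[of i j] by (simp add: base_def diag_def)
  next
    case False
    then show ?thesis using B_\<pi>[of i] by (auto simp: base_def diag_def)
  qed
  ultimately have "(\<lambda>k. base (d k) i j / scale (d k) i) \<longlonglongrightarrow> diag i j / 1"
    by (intro tendsto_divide) auto
  then show ?thesis by (simp add: normed_def)
qed

text \<open>For a weighted permutation matrix the symmetry conditions relate only
  \<open>X a (\<pi> b)\<close> and \<open>X b (\<pi> a)\<close>, and together they give
  \<open>((wt a)\<^sup>2 - (wt b)\<^sup>2) * X a (\<pi> b) = 0\<close>. Equal weights leave the
  transversal, where \<open>X\<close> vanishes by \<open>zero\<close>, and the pair
  \<open>0\<close>, \<open>m\<close>, where it vanishes by \<open>zero'\<close>.\<close>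

lemma sym_products_diag:
  assumes sym: "sym_products (m + n) diag X"
    and zero: "\<And>i j. B i j \<Longrightarrow> X i j = 0" and zero': "X 0 (\<pi> m) = 0"
    and ij: "i < m + n" "j < m + n"
  shows "X i j = 0"
proof -
  have \<pi>N: "\<pi> a < m + n" if "a < m + n" for a using that by (rule \<pi>_less)
  have s1: "(\<Sum>i<m + n. diag i (\<pi> a) * X i k) = wt a * X a k" if "a < m + n" for a k
  proof -
    have "(\<Sum>i<m + n. diag i (\<pi> a) * X i k) = (\<Sum>i<m + n. if i = a then wt a * X a k else 0)"
      using that \<pi>_inj[of a] by (intro sum.cong) (auto simp: diag_def)
    then show ?thesis using that by simp
  qed
  have s2: "(\<Sum>j<m + n. X i j * diag a j) = X i (\<pi> a) * wt a" if "a < m + n" for a i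
  proof -
    have "(\<Sum>j<m + n. X i j * diag a j) = (\<Sum>j<m + n. if j = \<pi> a then X i (\<pi> a) * wt a else 0)"
      using that by (intro sum.cong) (auto simp: diag_def)
    then show ?thesis using that \<pi>N by simp
  qed
  have e1: "wt a * X a (\<pi> b) = wt b * X b (\<pi> a)" if "a < m + n" "b < m + n" for a b
  proof -
    have "(\<Sum>i<m + n. diag i (\<pi> a) * X i (\<pi> b)) = (\<Sum>i<m + n. diag i (\<pi> b) * X i (\<pi> a))"
      using sym \<pi>N[OF that(1)] \<pi>N[OF that(2)] unfolding sym_products_def by blast
    then show ?thesis using s1 that by simp
  qed
  have e2: "X a (\<pi> b) * wt b = X b (\<pi> a) * wt a" if "a < m + n" "b < m + n" for a b
  proof -
    have "(\<Sum>j<m + n. X a j * diag b j) = (\<Sum>j<m + n. X b j * diag a j)"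
      using sym that unfolding sym_products_def by blast
    then show ?thesis using s2 that by simp
  qed
  obtain b where b: "b < m + n" "j = \<pi> b" using \<pi>_surj[OF ij(2)] by blast
  show ?thesis
  proof (cases "wt i = wt b")
    case True
    then consider "i = b" | "i = 0" "b = m" | "i = m" "b = 0"
      using wt_eq_iff by (auto simp: doubleton_eq_iff)
    then show ?thesis
    proof cases
      case 1
      then show ?thesis using zero B_\<pi> b by simp
    next
      case 2
      then show ?thesis using zero' b by simp
    next
      case 3
      then show ?thesis using zero' b e1[of i b] True wt_bounds(1)[of b] ij by simp
    qed
  next
    case False
    have "(wt i * wt i - wt b * wt b) * X i j = wt i * (wt i * X i (\<pi> b)) - wt b * (X i (\<pi> b) * wt b)"
      by (simp add: b algebra_simps)
    also have "\<dots> = 0" unfolding e1[OF ij(1) b(1)] e2[OF ij(1) b(1)] by simp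
    finally have "wt i * wt i = wt b * wt b \<or> X i j = 0" by simp
    then show ?thesis
      using False wt_bounds(1)[of i] wt_bounds(1)[of b] by (auto simp: square_eq_iff)
  qed
qed

text \<open>If no \<open>\<delta>\<close> worked, the nonzero solutions for
  \<open>\<delta> = 1 / (k + 1)\<close> would yield one for \<open>diag\<close>, against
  \<open>sym_products_diag\<close>. The extra zero at \<open>(0, \<pi> m)\<close> removes the
  solutions due to the common singular value.\<close>

lemma ex_rigid:
  obtains \<delta> where "\<delta> > 0" and "\<And>X i j. sym_products (m + n) (normed \<delta>) X \<Longrightarrow>
    (\<And>i j. B i j \<Longrightarrow> X i j = 0) \<Longrightarrow> X 0 (\<pi> m) = 0 \<Longrightarrow> i < m + n \<Longrightarrow> j < m + n \<Longrightarrow> X i j = 0"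
proof (rule ccontr)
  assume neg: "\<not> thesis"
  define d where "d k = 1 / real (Suc k)" for k
  have d: "d k > 0" for k by (simp add: d_def)
  have d0: "d \<longlonglongrightarrow> 0" unfolding d_def by (intro LIMSEQ_Suc lim_1_over_n)
  define Z where "Z = {(i, j). B i j} \<union> {(0, \<pi> m)}"
  have "\<exists>X. sym_products (m + n) diag X \<and> (\<forall>(i, j)\<in>Z. X i j = 0) \<and> (\<exists>i<m + n. \<exists>j<m + n. X i j \<noteq> 0)"
  proof (rule sym_products_limit)
    show "(\<lambda>k. normed (d k) i j) \<longlonglongrightarrow> diag i j" for i j
      by (rule normed_tendsto[OF d0 d])
    show "\<exists>X. sym_products (m + n) (normed (d k)) X \<and> (\<forall>(i, j)\<in>Z. X i j = 0) \<and>
        (\<exists>i<m + n. \<exists>j<m + n. X i j \<noteq> 0)" for k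
    proof (rule ccontr)
      assume *: "\<not> ?thesis"
      have thesis
      proof (rule that[OF d[of k]])
        fix X i j assume "sym_products (m + n) (normed (d k)) X" "\<And>i j. B i j \<Longrightarrow> X i j = 0"
          "X 0 (\<pi> m) = 0" "i < m + n" "j < m + n"
        then show "X i j = 0" using * unfolding Z_def by blast
      qed
      with neg show False ..
    qed
    show "Z \<subseteq> {..<m + n} \<times> {..<m + n}"
      using B_block \<pi>_less[of m] mn by (auto simp: Z_def)
  qed
  then obtain X where "sym_products (m + n) diag X" "\<forall>(i, j)\<in>Z. X i j = 0"
    "\<exists>i<m + n. \<exists>j<m + n. X i j \<noteq> 0" by blast
  then show False using sym_products_diag[of X] by (auto simp: Z_def)
qed

end

lemma sym_products_diff_scaled:
  assumes "sym_products N M X" "sym_products N M Y"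
  shows "sym_products N M (\<lambda>i j. X i j - c * Y i j)"
proof -
  have 1: "(\<Sum>i<N. f i * (g i - c * h i)) = (\<Sum>i<N. f i * g i) - c * (\<Sum>i<N. f i * h i)"
    and 2: "(\<Sum>i<N. (g i - c * h i) * f i) = (\<Sum>i<N. g i * f i) - c * (\<Sum>i<N. h i * f i)"
    for f g h :: "nat \<Rightarrow> real"
    by (simp_all add: algebra_simps sum_subtractf sum_distrib_left)
  show ?thesis using assms unfolding sym_products_def 1 2 by simp
qed

subsection \<open>Coupling the blocks\<close>

context block_pattern
begin

text \<open>The products \<open>A\<^sup>T * X\<close> and \<open>X * A\<^sup>T\<close> are symmetric for the off-diagonal
  matrix \<open>X\<^sub>0\<close> built from the Perron vector, and \<open>X\<^sub>0\<close> spans all such \<open>X\<close> that vanish on the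
  diagonal pattern. As it has no zero entry off the diagonal blocks, a single position there
  suffices to exclude it.\<close>

lemma ex_rigid_across:
  obtains \<delta> where "\<delta> > 0" and "\<And>X a b i j. sym_products (m + n) (normed \<delta>) X \<Longrightarrow>
    (\<And>i j. B i j \<Longrightarrow> X i j = 0) \<Longrightarrow> a < m + n \<Longrightarrow> b < m + n \<Longrightarrow> (a < m) \<noteq> (b < m) \<Longrightarrow> X a b = 0 \<Longrightarrow>
    i < m + n \<Longrightarrow> j < m + n \<Longrightarrow> X i j = 0"
proof -
  obtain \<delta> where \<delta>: "\<delta> > 0" and rigid: "\<And>X i j. sym_products (m + n) (normed \<delta>) X \<Longrightarrow>
    (\<And>i j. B i j \<Longrightarrow> X i j = 0) \<Longrightarrow> X 0 (\<pi> m) = 0 \<Longrightarrow> i < m + n \<Longrightarrow> j < m + n \<Longrightarrow> X i j = 0"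
    by (rule ex_rigid) blast
  obtain p where pos: "\<And>a. a \<in> verts_on {..<m + n} \<Longrightarrow> p a > 0"
    and ev: "eigvec (verts_on {..<m + n}) (bip (normed \<delta>)) 1 p"
    using normed_eigvec[OF \<delta>] by blast
  define X0 where "X0 i j = (if (i < m) = (j < m) then 0 else p (Inl i) * p (Inr j))" for i j
  have X0_pos: "X0 i j > 0" if "i < m + n" "j < m + n" "(i < m) \<noteq> (j < m)" for i j
    using that pos by (simp add: X0_def)
  have normed_0: "normed \<delta> i j = 0" if "(i < m) \<noteq> (j < m)" for i j
    using that B_block[of i j] by (auto simp: normed_def base_def)
  have s1: "(\<Sum>i<m + n. normed \<delta> i j * X0 i k) = (if (j < m) = (k < m) then 0 else p (Inr j) * p (Inr k))"
    if "j < m + n" for j k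
  proof -
    \<comment> \<open>Since \<open>normed \<delta>\<close> vanishes across the blocks, the block
      test on \<open>i\<close> can be replaced by one on \<open>j\<close>; then the eigenvector
      equation applies.\<close>
    have "(\<Sum>i<m + n. normed \<delta> i j * X0 i k) =
        (\<Sum>i<m + n. (normed \<delta> i j * p (Inl i)) * (if (j < m) = (k < m) then 0 else p (Inr k)))"
      using normed_0 by (intro sum.cong refl) (auto simp: X0_def)
    also have "\<dots> = p (Inr j) * (if (j < m) = (k < m) then 0 else p (Inr k))"
      using ev that by (simp add: eigvec_bip_iff flip: sum_distrib_right)
    finally show ?thesis by simp
  qed
  have s2: "(\<Sum>j<m + n. X0 i j * normed \<delta> l j) = (if (i < m) = (l < m) then 0 else p (Inl i) * p (Inl l))"
    if "l < m + n" for i l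
  proof -
    have "(\<Sum>j<m + n. X0 i j * normed \<delta> l j) =
        (\<Sum>j<m + n. (normed \<delta> l j * p (Inr j)) * (if (i < m) = (l < m) then 0 else p (Inl i)))"
      using normed_0 by (intro sum.cong refl) (auto simp: X0_def)
    also have "\<dots> = p (Inl l) * (if (i < m) = (l < m) then 0 else p (Inl i))"
      using ev that by (simp add: eigvec_bip_iff flip: sum_distrib_right)
    finally show ?thesis by simp
  qed
  have X0_sym: "sym_products (m + n) (normed \<delta>) X0"
    unfolding sym_products_def
  proof (intro conjI allI impI)
    fix j k assume jk: "j < m + n" "k < m + n"
    show "(\<Sum>i<m + n. normed \<delta> i j * X0 i k) = (\<Sum>i<m + n. normed \<delta> i k * X0 i j)"
      unfolding s1[OF jk(1)] s1[OF jk(2)] by (auto simp: mult.commute)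
    show "(\<Sum>i<m + n. X0 j i * normed \<delta> k i) = (\<Sum>i<m + n. X0 k i * normed \<delta> j i)"
      unfolding s2[OF jk(1)] s2[OF jk(2)] by (auto simp: mult.commute)
  qed
  show thesis
  proof (rule that[OF \<delta>])
    fix X a b i j
    assume X: "sym_products (m + n) (normed \<delta>) X" and zero: "\<And>i j. B i j \<Longrightarrow> X i j = 0"
      and ab: "a < m + n" "b < m + n" "(a < m) \<noteq> (b < m)" "X a b = 0" and ij: "i < m + n" "j < m + n"
    \<comment> \<open>With this \<open>c\<close>, \<open>X - c X0\<close> also vanishes at
      \<open>(0, \<pi> m)\<close>, so \<open>rigid\<close> makes it zero; then
      \<open>X a b = 0\<close> and \<open>X0 a b > 0\<close> force \<open>c = 0\<close>.\<close>
    define c where "c = X 0 (\<pi> m) / X0 0 (\<pi> m)"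
    have "X0 0 (\<pi> m) > 0" using mn \<pi>_less[of m] by (intro X0_pos) auto
    then have c: "X 0 (\<pi> m) - c * X0 0 (\<pi> m) = 0" by (simp add: c_def)
    have sym: "sym_products (m + n) (normed \<delta>) (\<lambda>i j. X i j - c * X0 i j)"
      using X X0_sym by (rule sym_products_diff_scaled)
    have eq: "X i j - c * X0 i j = 0" if "i < m + n" "j < m + n" for i j
      using rigid[OF sym _ c that] zero B_block by (simp add: X0_def)
    have "c = 0" using eq[OF ab(1,2)] ab(4) X0_pos[OF ab(1-3)] by simp
    then show "X i j = 0" using eq[OF ij] by simp
  qed
qed

text \<open>Matrices with pattern \<open>G\<close> and a multiple singular value converge to
  \<open>normed \<delta>\<close>. If all of them failed the SSVP, a limit solution would vanish on
  \<open>B\<close> and at \<open>(i0, j0)\<close>, which \<open>rigid\<close> excludes. Position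
  \<open>(i0, j0)\<close> holds the free entry, \<open>(i1, j1)\<close> a guaranteed
  coupling.\<close>

lemma ex_SSVP_multiple_singular_value:
  assumes G_B: "\<And>i j. i < m + n \<Longrightarrow> j < m + n \<Longrightarrow> (i < m) = (j < m) \<Longrightarrow> G i j \<longleftrightarrow> B i j"
    and ij0: "i0 < m + n" "j0 < m + n" "(i0 < m) \<noteq> (j0 < m)" "G i0 j0"
    and ij1: "i1 < m + n" "j1 < m + n" "(i1 < m) \<noteq> (j1 < m)" "G i1 j1"
    and ne: "(i0, j0) \<noteq> (i1, j1)"
  obtains M where "\<And>i j. i < m + n \<Longrightarrow> j < m + n \<Longrightarrow> M i j \<noteq> 0 \<longleftrightarrow> G i j"
    and "SSVP (mat (m + n) (m + n) (\<lambda>(i, j). M i j))"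
    and "has_multiple_singular_value (mat (m + n) (m + n) (\<lambda>(i, j). M i j))"
proof -
  obtain \<delta> where \<delta>: "\<delta> > 0" and rigid: "\<And>X a b i j. sym_products (m + n) (normed \<delta>) X \<Longrightarrow>
    (\<And>i j. B i j \<Longrightarrow> X i j = 0) \<Longrightarrow> a < m + n \<Longrightarrow> b < m + n \<Longrightarrow> (a < m) \<noteq> (b < m) \<Longrightarrow> X a b = 0 \<Longrightarrow>
    i < m + n \<Longrightarrow> j < m + n \<Longrightarrow> X i j = 0"
    by (rule ex_rigid_across) blast
  obtain p where pos: "\<And>a. a \<in> verts_on {..<m + n} \<Longrightarrow> p a > 0"
    and ev: "eigvec (verts_on {..<m + n}) (bip (normed \<delta>)) 1 p"
    using normed_eigvec[OF \<delta>] by blast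
  define K where "K i j = (of_bool (i < m + n \<and> j < m + n \<and> (i < m) \<noteq> (j < m) \<and> G i j \<and> (i, j) \<noteq> (i0, j0)) :: real)" for i j
  define sg where "sg i = (if i < m then 1 else -1 :: real)" for i
  \<comment> \<open>The end in the first block is named first: the row vertex for a position in
    \<open>E\<close>, the column vertex for one in \<open>F\<close>.\<close>
  define a b c d where "a = (if i0 < m then Inl i0 else Inr j0)" and "b = (if i0 < m then Inr j0 else Inl i0)"
    and "c = (if i1 < m then Inl i1 else Inr j1)" and "d = (if i1 < m then Inr j1 else Inl i1)"
  have "{..<m + n} = {..<m} \<union> {m..<m + n}" by auto
  then have verts: "verts_on {..<m + n} = verts_on {..<m} \<union> verts_on {m..<m + n}"
    by (simp only: verts_on_def image_Un Un_ac)
  have normed_0: "normed \<delta> i j = 0" if "(i < m) \<noteq> (j < m)" for i j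
    using that B_block[of i j] by (auto simp: normed_def base_def)
  interpret tb: two_blocks "verts_on {..<m}" "verts_on {m..<m + n}" "bip (normed \<delta>)" "bip K" p a b c d
  proof
    show "bip (normed \<delta>) q r = bip (normed \<delta>) r q" "bip K q r = bip K r q" for q r
      by (rule bip_commute)+
    show "0 \<le> bip (normed \<delta>) q r" for q r
      using normed_nonneg[OF \<delta>] by (cases q; cases r) auto
    show "0 \<le> bip K q r" for q r
      by (cases q; cases r) (auto simp: K_def)
    show "bip (normed \<delta>) q r = 0" if "q \<in> verts_on {..<m}" "r \<in> verts_on {m..<m + n}" for q r
      using that normed_0 by (cases q; cases r) auto
    show "bip K q r = 0" if "q \<in> verts_on {..<m}" "r \<in> verts_on {..<m}" for q r
      using that by (cases q; cases r) (auto simp: K_def)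
    show "bip K q r = 0" if "q \<in> verts_on {m..<m + n}" "r \<in> verts_on {m..<m + n}" for q r
      using that by (cases q; cases r) (auto simp: K_def)
    show "0 < p q" if "q \<in> verts_on {..<m} \<union> verts_on {m..<m + n}" for q
      using pos that verts by auto
    show "eigvec (verts_on {..<m} \<union> verts_on {m..<m + n}) (bip (normed \<delta>)) 1 p"
      using ev verts by simp
    show "a \<in> verts_on {..<m}" "b \<in> verts_on {m..<m + n}" "c \<in> verts_on {..<m}" "d \<in> verts_on {m..<m + n}"
      using ij0 ij1 by (auto simp: a_def b_def c_def d_def)
    show "0 < bip K c d"
      using ij1 ne by (auto simp: c_def d_def K_def)
  qed (use conn_normed[OF \<delta>] in \<open>auto simp: verts_on_def\<close>)
  define M where "M s e x i j = (1 + s * sg i) * normed \<delta> i j + e * K i j + x * of_bool (i = i0 \<and> j = j0)" for s e x i j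
  have V: "tb.V = verts_on {..<m + n}" using verts by (simp add: tb.V_def)
  have entry: "tb.pert s e x (Inl i) (Inr j) = M s e x i j"
    if "i < m + n" "j < m + n" for s e x i j
  proof -
    have "edge a b (Inl i) (Inr j) = of_bool (i = i0 \<and> j = j0)"
      by (auto simp: edge_def a_def b_def)
    then show ?thesis by (simp add: tb.pert_def M_def tb.sg_def sg_def)
  qed
  have pert: "tb.pert s e x q r = bip (M s e x) q r" if "q \<in> tb.V" "r \<in> tb.V" for s e x q r
  proof (cases q; cases r)
    fix i j assume "q = Inl i" "r = Inr j"
    then show ?thesis using that entry by (simp add: V)
  next
    fix i j assume "q = Inr j" "r = Inl i"
    then show ?thesis using that entry tb.pert_sym[OF that] by (simp add: V)
  next
    fix i j assume "q = Inl i" "r = Inl j"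
    then show ?thesis by (simp add: tb.pert_def) (auto simp: edge_def a_def b_def)
  next
    fix i j assume "q = Inr i" "r = Inr j"
    then show ?thesis by (simp add: tb.pert_def) (auto simp: edge_def a_def b_def)
  qed
  have pattern: "M s e x i j \<noteq> 0 \<longleftrightarrow> G i j"
    if "\<bar>s\<bar> < 1" "e > 0" "x \<noteq> 0" "i < m + n" "j < m + n" for s e x i j
  proof (cases "(i < m) = (j < m)")
    case True
    then have "\<not> (i = i0 \<and> j = j0)" "K i j = 0" using ij0 by (auto simp: K_def)
    moreover have "1 + s * sg i \<noteq> 0" using that by (auto simp: sg_def)
    ultimately show ?thesis
      using G_B[OF that(4,5) True] normed_nonzero_iff[OF \<delta>] by (auto simp: M_def)
  next
    case False
    then have "normed \<delta> i j = 0" by (rule normed_0)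
    then show ?thesis using that False ij0(4) by (auto simp: M_def K_def)
  qed
  define D where "D k = 1 / real (Suc k)" for k
  have D: "D k > 0" "D k \<le> 1" for k by (simp_all add: D_def)
  have D0: "D \<longlonglongrightarrow> 0" unfolding D_def by (intro LIMSEQ_Suc lim_1_over_n)
  have "\<forall>k. \<exists>y. case y of (s, e, x) \<Rightarrow> \<bar>s\<bar> < D k \<and> 0 < e \<and> e < D k \<and> \<bar>x\<bar> < D k \<and> x \<noteq> 0 \<and>
      has_multiple_singular_value (mat (m + n) (m + n) (\<lambda>(i, j). M s e x i j))"
  proof
    fix k
    show "\<exists>y. case y of (s, e, x) \<Rightarrow> \<bar>s\<bar> < D k \<and> 0 < e \<and> e < D k \<and> \<bar>x\<bar> < D k \<and> x \<noteq> 0 \<and>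
      has_multiple_singular_value (mat (m + n) (m + n) (\<lambda>(i, j). M s e x i j))"
    proof (rule tb.ex_double_eigenvalue[OF D(1)[of k]])
      fix s e x t w w'
      assume *: "\<bar>s\<bar> < D k" "0 < e" "e < D k" "\<bar>x\<bar> < D k" "x \<noteq> 0" "t > 0"
        and ew: "eigvec tb.V (tb.pert s e x) t w" "eigvec tb.V (tb.pert s e x) t w'"
        and ind: "independent_pair tb.V w w'"
      have "eigvec tb.V (tb.pert s e x) t y \<longleftrightarrow> eigvec tb.V (bip (M s e x)) t y" for y
        unfolding eigvec_def by (intro ball_cong refl arg_cong2[of _ _ _ _ "(=)"] sum.cong) (simp add: pert)
      then have "has_multiple_singular_value (mat (m + n) (m + n) (\<lambda>(i, j). M s e x i j))"
        using ew ind \<open>t > 0\<close> unfolding V by (intro has_multiple_singular_valueI[of _ _ t w w']) auto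
      then show ?thesis using * by (intro exI[of _ "(s, e, x)"]) simp
    qed
  qed
  from choice[OF this] obtain y where y: "\<And>k. case y k of (s, e, x) \<Rightarrow> \<bar>s\<bar> < D k \<and> 0 < e \<and> e < D k \<and> \<bar>x\<bar> < D k \<and> x \<noteq> 0 \<and>
      has_multiple_singular_value (mat (m + n) (m + n) (\<lambda>(i, j). M s e x i j))" by blast
  define s e x where "s k = fst (y k)" and "e k = fst (snd (y k))" and "x k = snd (snd (y k))" for k
  have sex: "\<bar>s k\<bar> < D k" "0 < e k" "e k < D k" "\<bar>x k\<bar> < D k" "x k \<noteq> 0"
    "has_multiple_singular_value (mat (m + n) (m + n) (\<lambda>(i, j). M (s k) (e k) (x k) i j))" for k
    using y[of k] by (auto simp: s_def e_def x_def split: prod.splits)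
  have to0: "f \<longlonglongrightarrow> 0" if "\<And>k. \<bar>f k\<bar> < D k" for f
    using that D(1) by (intro tendsto_0_le[OF D0, of _ 1] always_eventually allI) (simp add: less_imp_le)
  have s0: "s \<longlonglongrightarrow> 0" by (rule to0) (rule sex(1))
  have x0: "x \<longlonglongrightarrow> 0" by (rule to0) (rule sex(4))
  have e0: "e \<longlonglongrightarrow> 0" by (rule to0) (use sex(2,3) in \<open>simp add: abs_of_pos\<close>)
  have lim: "(\<lambda>k. M (s k) (e k) (x k) i j) \<longlonglongrightarrow> normed \<delta> i j" for i j
  proof -
    have "(\<lambda>k. M (s k) (e k) (x k) i j) \<longlonglongrightarrow>
        (1 + 0 * sg i) * normed \<delta> i j + 0 * K i j + 0 * of_bool (i = i0 \<and> j = j0)"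
      unfolding M_def by (intro tendsto_intros s0 e0 x0)
    then show ?thesis by simp
  qed
  have pat: "M (s k) (e k) (x k) i j \<noteq> 0 \<longleftrightarrow> G i j" if "i < m + n" "j < m + n" for k i j
  proof (rule pattern)
    show "\<bar>s k\<bar> < 1" using sex(1)[of k] D(2)[of k] by simp
  qed (use sex that in auto)
  \<comment> \<open>The zeros are prescribed on all of \<open>G\<close>, the common pattern for
    every \<open>k\<close>; so the limit solution still vanishes at \<open>(i0, j0)\<close>, where
    \<open>normed \<delta>\<close> is 0.\<close>
  define Z where "Z = {(i, j). i < m + n \<and> j < m + n \<and> G i j}"
  have "\<exists>k. SSVP (mat (m + n) (m + n) (\<lambda>(i, j). M (s k) (e k) (x k) i j))"
  proof (rule ccontr)
    assume neg: "\<not> ?thesis"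
    have "\<exists>X. sym_products (m + n) (normed \<delta>) X \<and> (\<forall>(i, j)\<in>Z. X i j = 0) \<and> (\<exists>i<m + n. \<exists>j<m + n. X i j \<noteq> 0)"
    proof (rule sym_products_limit[OF lim])
      fix k
      have "\<not> SSVP (mat (m + n) (m + n) (\<lambda>(i, j). M (s k) (e k) (x k) i j))" using neg by blast
      then obtain X where X: "sym_products (m + n) (M (s k) (e k) (x k)) X"
        "\<And>i j. i < m + n \<Longrightarrow> j < m + n \<Longrightarrow> M (s k) (e k) (x k) i j \<noteq> 0 \<Longrightarrow> X i j = 0"
        "\<exists>i<m + n. \<exists>j<m + n. X i j \<noteq> 0"
        unfolding SSVP_mat_iff by blast
      have "\<forall>(i, j)\<in>Z. X i j = 0" using X(2) pat by (auto simp: Z_def)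
      with X(1,3) show "\<exists>X. sym_products (m + n) (M (s k) (e k) (x k)) X \<and> (\<forall>(i, j)\<in>Z. X i j = 0) \<and>
          (\<exists>i<m + n. \<exists>j<m + n. X i j \<noteq> 0)" by blast
    qed (auto simp: Z_def)
    then obtain X where X: "sym_products (m + n) (normed \<delta>) X" "\<forall>(i, j)\<in>Z. X i j = 0"
      and nz: "\<exists>i<m + n. \<exists>j<m + n. X i j \<noteq> 0" by blast
    have "X i j = 0" if "B i j" for i j
      using X(2) G_B[of i j] B_block[OF that] that by (auto simp: Z_def)
    moreover have "X i0 j0 = 0" using X(2) ij0 by (auto simp: Z_def)
    ultimately show False using rigid[OF X(1) _ ij0(1-3)] nz by blast
  qed
  then obtain k where "SSVP (mat (m + n) (m + n) (\<lambda>(i, j). M (s k) (e k) (x k) i j))" by blast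
  then show thesis using that[of "M (s k) (e k) (x k)"] pat sex(6) by blast
qed

end

section \<open>Term-rank, connectivity and assembly of the block matrix\<close>

text \<open>A largest admissible set \<open>S\<close> has \<open>m\<close> positions, so both
  projections onto the \<open>m\<close> indices are bijective and \<open>S\<close> is the graph of a
  permutation.\<close>

lemma full_term_rank_perm:
  assumes P: "P \<in> carrier_mat m m" "is_pattern P" and rank: "term_rank P = m"
  obtains \<sigma> where "bij_betw \<sigma> {..<m} {..<m}" and "\<And>i. i < m \<Longrightarrow> P $$ (i, \<sigma> i) = 1"
proof -
  let ?F = "{card S | S. S \<subseteq> nonzero_positions P \<and> inj_on fst S \<and> inj_on snd S}"
  have sub: "nonzero_positions P \<subseteq> {..<m} \<times> {..<m}"
    using P by (auto simp: nonzero_positions_def)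
  have fin: "finite (nonzero_positions P)" by (rule finite_subset[OF sub]) simp
  have "?F = card ` {S. S \<subseteq> nonzero_positions P \<and> inj_on fst S \<and> inj_on snd S}" by auto
  moreover have "finite {S. S \<subseteq> nonzero_positions P \<and> inj_on fst S \<and> inj_on snd S}"
    by (rule finite_subset[of _ "Pow (nonzero_positions P)"]) (use fin in auto)
  ultimately have "finite ?F" by simp
  moreover have "?F \<noteq> {}" by (auto intro!: exI[of _ "{}"])
  ultimately have "m \<in> ?F" using Max_in[of ?F] rank by (simp add: term_rank_def)
  then obtain S where S: "card S = m" "S \<subseteq> nonzero_positions P" "inj_on fst S" "inj_on snd S" by auto
  have img: "fst ` S = {..<m}" "snd ` S = {..<m}"
  proof -
    show "fst ` S = {..<m}" using S sub by (intro card_subset_eq) (auto simp: card_image)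
    show "snd ` S = {..<m}" using S sub by (intro card_subset_eq) (auto simp: card_image)
  qed
  have fst: "bij_betw fst S {..<m}" and snd: "bij_betw snd S {..<m}"
    using S img by (simp_all add: bij_betw_def)
  define \<sigma> where "\<sigma> = snd \<circ> inv_into S fst"
  have "bij_betw \<sigma> {..<m} {..<m}"
    unfolding \<sigma>_def by (rule bij_betw_trans[OF bij_betw_inv_into[OF fst] snd])
  moreover have "P $$ (i, \<sigma> i) = 1" if "i < m" for i
  proof -
    have "inv_into S fst i \<in> S" "fst (inv_into S fst i) = i"
      using that img(1) inv_into_into[of i fst S] f_inv_into_f[of i fst S] by auto
    then have "(i, \<sigma> i) \<in> S" unfolding \<sigma>_def by (metis comp_apply prod.collapse)
    then have nz: "i < m" "\<sigma> i < m" "P $$ (i, \<sigma> i) \<noteq> 0"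
      using S(2) P(1) by (auto simp: nonzero_positions_def)
    then have "P $$ (i, \<sigma> i) \<in> elements_mat P" by (intro elements_matI[OF P(1)]) auto
    then show ?thesis using P(2) nz(3) by (auto simp: is_pattern_def)
  qed
  ultimately show thesis using that by blast
qed

text \<open>Membership in a set closed under adjacency travels along the paths of the symmetrized
  bigraph, whose vertices are shifted by \<open>k\<close> to the place of the diagonal block. A
  connected graph has a vertex, whence \<open>m > 0\<close>.\<close>

lemma bigraph_connected_imp_graph_connected:
  assumes P: "P \<in> carrier_mat m m" and conn: "bigraph_connected P"
    and B: "\<And>i j. i < m \<Longrightarrow> j < m \<Longrightarrow> P $$ (i, j) = 1 \<Longrightarrow> B (k + i) (k + j)"
  shows "graph_connected (verts_on {k..<k + m}) (bip (\<lambda>i j. of_bool (B i j)))" and "m > 0"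
proof -
  let ?S = "with_proj (mk_symmetric (with_proj (bigraph P)))"
  let ?f = "map_sum ((+) k) ((+) k)"
  have vS: "verts ?S = verts_on {..<m}"
    using P by (auto simp: bigraph_def verts_on_def)
  have sc: "verts ?S \<noteq> {}" "\<And>u v. u \<in> verts ?S \<Longrightarrow> v \<in> verts ?S \<Longrightarrow> u \<rightarrow>\<^sup>*\<^bsub>?S\<^esub> v"
    using conn by (auto simp: connected_def strongly_connected_def)
  show "m > 0" using sc(1) vS by (auto simp: verts_on_def)
  show "graph_connected (verts_on {k..<k + m}) (bip (\<lambda>i j. of_bool (B i j)))"
    unfolding graph_connected_def
  proof (intro allI impI)
    fix R assume R: "R \<subseteq> verts_on {k..<k + m}" "R \<noteq> {}"
      and closed: "\<forall>a\<in>verts_on {k..<k + m}. \<forall>b\<in>verts_on {k..<k + m}.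
        bip (\<lambda>i j. of_bool (B i j)) a b \<noteq> 0 \<longrightarrow> (a \<in> R) = (b \<in> R)"
    have step: "?f u \<in> R \<longleftrightarrow> ?f v \<in> R" if "(u, v) \<in> arcs_ends ?S" for u v
    proof -
      have "(u, v) \<in> parcs (mk_symmetric (with_proj (bigraph P)))"
        using that by (simp add: arcs_ends_def arc_to_ends_def)
      then obtain i j where ij: "i < m" "j < m" "P $$ (i, j) = 1"
        and uv: "u = Inl i \<and> v = Inr j \<or> u = Inr j \<and> v = Inl i"
        using P by (auto simp: parcs_mk_symmetric bigraph_def)
      have "B (k + i) (k + j)" using B ij by blast
      then have "Inl (k + i) \<in> R \<longleftrightarrow> Inr (k + j) \<in> R"
        using closed ij by (auto simp: ball_verts_on)
      then show ?thesis using uv by auto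
    qed
    have f_surj: "\<exists>u\<in>verts ?S. q = ?f u" if q: "q \<in> verts_on {k..<k + m}" for q
      using q
    proof (cases rule: verts_on_cases)
      case (1 i)
      then show ?thesis unfolding vS by (intro bexI[of _ "Inl (i - k)"]) auto
    next
      case (2 i)
      then show ?thesis unfolding vS by (intro bexI[of _ "Inr (i - k)"]) auto
    qed
    obtain q0 where "q0 \<in> R" using R(2) by blast
    then obtain u0 where u0: "u0 \<in> verts ?S" "?f u0 \<in> R" using f_surj[of q0] R(1) by blast
    have reach: "?f v \<in> R" if "(u0, v) \<in> (arcs_ends ?S)\<^sup>*" for v
      using that by (induction rule: rtrancl_induct) (use u0 step in auto)
    have "q \<in> R" if q: "q \<in> verts_on {k..<k + m}" for q
    proof -
      obtain u where u: "u \<in> verts ?S" "q = ?f u" using f_surj[OF q] by blast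
      then show ?thesis using reach reachable_rtranclI[OF sc(2)[OF u0(1) u(1)]] by simp
    qed
    then show "R = verts_on {k..<k + m}" using R(1) by blast
  qed
qed

theorem theorem2p5:
  fixes m n :: nat and P Q E F :: "nat mat"
  assumes "P \<in> carrier_mat m m" and "is_pattern P"
    and "Q \<in> carrier_mat n n" and "is_pattern Q"
    and "term_rank P = m" and "term_rank Q = n"
    and "bigraph_connected P" and "bigraph_connected Q"
    and "E \<in> carrier_mat m n" and "is_pattern E"
    and "F \<in> carrier_mat n m" and "is_pattern F"
    and "card (nonzero_positions E) + card (nonzero_positions F) \<ge> 2"
  shows "\<exists>A :: real mat. has_pattern A (four_block_mat P E F Q) \<and> SSVP A \<and>
    has_multiple_singular_value A"
proof -
  let ?M = "four_block_mat P E F Q"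
  have M: "?M \<in> carrier_mat (m + n) (m + n)" using assms by simp
  have entry: "?M $$ (i, j) = (if i < m then if j < m then P $$ (i, j) else E $$ (i, j - m)
      else if j < m then F $$ (i - m, j) else Q $$ (i - m, j - m))"
    if "i < m + n" "j < m + n" for i j
    using that assms by simp
  have one: "A $$ (i, j) = 1" if "is_pattern A" "(i, j) \<in> nonzero_positions A" for A :: "nat mat" and i j
    using that by (fastforce simp: is_pattern_def nonzero_positions_def elements_mat_def)
  define G where "G i j \<longleftrightarrow> ?M $$ (i, j) = 1" for i j
  define B where "B i j \<longleftrightarrow> i < m + n \<and> j < m + n \<and> (i < m) = (j < m) \<and> G i j" for i j
  obtain \<sigma> where \<sigma>: "bij_betw \<sigma> {..<m} {..<m}" "\<And>i. i < m \<Longrightarrow> P $$ (i, \<sigma> i) = 1"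
    using full_term_rank_perm[of P m] assms by blast
  obtain \<tau> where \<tau>: "bij_betw \<tau> {..<n} {..<n}" "\<And>i. i < n \<Longrightarrow> Q $$ (i, \<tau> i) = 1"
    using full_term_rank_perm[of Q n] assms by blast
  have \<sigma>_less: "\<sigma> i < m" if "i < m" for i using bij_betwE[OF \<sigma>(1)] that by auto
  have \<tau>_less: "\<tau> i < n" if "i < n" for i using bij_betwE[OF \<tau>(1)] that by auto
  define \<pi> where "\<pi> i = (if i < m then \<sigma> i else m + \<tau> (i - m))" for i
  have connP: "graph_connected (verts_on {0..<0 + m}) (bip (\<lambda>i j. of_bool (B i j)))" and m: "m > 0"
    using assms(1) by (intro bigraph_connected_imp_graph_connected[OF assms(1,7)]; simp add: B_def G_def)+
  have connQ: "graph_connected (verts_on {m..<m + n}) (bip (\<lambda>i j. of_bool (B i j)))" and n: "n > 0"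
    using assms(1,3) by (intro bigraph_connected_imp_graph_connected[OF assms(3,8)]; simp add: B_def G_def)+
  interpret block_pattern m n \<pi> B
  proof
    show "bij_betw \<pi> {..<m} {..<m}"
      using \<sigma>(1) by (subst bij_betw_cong[of _ _ \<sigma>]) (auto simp: \<pi>_def)
    have "bij_betw (\<lambda>i. i - m) {m..<m + n} {..<n}"
      by (rule bij_betw_byWitness[of _ "\<lambda>i. i + m"]) auto
    moreover have "bij_betw (\<lambda>i. m + i) {..<n} {m..<m + n}"
      by (rule bij_betw_byWitness[of _ "\<lambda>i. i - m"]) auto
    ultimately have "bij_betw ((\<lambda>i. m + i) \<circ> (\<tau> \<circ> (\<lambda>i. i - m))) {m..<m + n} {m..<m + n}"
      using \<tau>(1) by (blast intro: bij_betw_trans)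
    then show "bij_betw \<pi> {m..<m + n} {m..<m + n}"
      by (subst bij_betw_cong[of _ _ "(\<lambda>i. m + i) \<circ> (\<tau> \<circ> (\<lambda>i. i - m))"]) (auto simp: \<pi>_def)
    show "B i (\<pi> i)" if "i < m + n" for i
    proof (cases "i < m")
      case True
      then show ?thesis using that \<sigma>(2)[of i] \<sigma>_less[of i] entry[of i "\<sigma> i"]
        by (simp add: B_def G_def \<pi>_def)
    next
      case False
      then have "i - m < n" using that by simp
      then show ?thesis using that False \<tau>(2)[of "i - m"] \<tau>_less[of "i - m"] entry[of i "m + \<tau> (i - m)"]
        by (simp add: B_def G_def \<pi>_def)
    qed
    show "graph_connected (verts_on {..<m}) (bip (\<lambda>i j. of_bool (B i j)))"
      using connP by (simp add: lessThan_atLeast0)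
  qed (use m n connQ in \<open>auto simp: B_def\<close>)
  \<comment> \<open>The nonzero positions of \<open>E\<close> and \<open>F\<close> inside the block
    matrix. The two images are disjoint, so the count yields two distinct positions, in the same or
    in different blocks.\<close>
  define X where "X = (\<lambda>(i, j). (i, m + j)) ` nonzero_positions E \<union> (\<lambda>(i, j). (m + i, j)) ` nonzero_positions F"
  have X: "i < m + n \<and> j < m + n \<and> (i < m) \<noteq> (j < m) \<and> G i j" if "(i, j) \<in> X" for i j
    using that unfolding X_def
  proof (elim UnE imageE)
    fix z assume z: "(i, j) = (case z of (i, j) \<Rightarrow> (i, m + j))" "z \<in> nonzero_positions E"
    then have "i < m" "m \<le> j" "j < m + n" "(i, j - m) \<in> nonzero_positions E"
      using assms(9) by (auto simp: nonzero_positions_def split: prod.splits)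
    then show ?thesis using entry[of i j] one[OF assms(10)] by (simp add: G_def)
  next
    fix z assume z: "(i, j) = (case z of (i, j) \<Rightarrow> (m + i, j))" "z \<in> nonzero_positions F"
    then have "j < m" "m \<le> i" "i < m + n" "(i - m, j) \<in> nonzero_positions F"
      using assms(11) by (auto simp: nonzero_positions_def split: prod.splits)
    then show ?thesis using entry[of i j] one[OF assms(12)] by (simp add: G_def)
  qed
  have fin: "finite (nonzero_positions A)" for A :: "nat mat"
    by (rule finite_subset[of _ "{..<dim_row A} \<times> {..<dim_col A}"]) (auto simp: nonzero_positions_def)
  have "card ((\<lambda>(i, j). (i, m + j)) ` nonzero_positions E) = card (nonzero_positions E)"
    "card ((\<lambda>(i, j). (m + i, j)) ` nonzero_positions F) = card (nonzero_positions F)"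
    by (intro card_image; auto simp: inj_on_def)+
  then have "card X = card (nonzero_positions E) + card (nonzero_positions F)"
    unfolding X_def
  proof (subst card_Un_disjoint)
    show "(\<lambda>(i, j). (i, m + j)) ` nonzero_positions E \<inter> (\<lambda>(i, j). (m + i, j)) ` nonzero_positions F = {}"
      using assms(9) by (auto simp: nonzero_positions_def)
  qed (auto simp: fin)
  then have "2 \<le> card X" using assms(13) by simp
  then obtain z z' where z: "z \<in> X" "z' \<in> X" "z \<noteq> z'"
    by (metis card_le_Suc0_iff_eq card.infinite not_less_eq_eq numeral_2_eq_2 zero_le)
  obtain i0 j0 where z0: "z = (i0, j0)" by (cases z)
  obtain i1 j1 where z1: "z' = (i1, j1)" by (cases z')
  have G_B: "G i j \<longleftrightarrow> B i j" if "i < m + n" "j < m + n" "(i < m) = (j < m)" for i j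
    using that by (simp add: B_def)
  have X0: "i0 < m + n" "j0 < m + n" "(i0 < m) \<noteq> (j0 < m)" "G i0 j0"
    and X1: "i1 < m + n" "j1 < m + n" "(i1 < m) \<noteq> (j1 < m)" "G i1 j1"
    and ne: "(i0, j0) \<noteq> (i1, j1)"
    using X[of i0 j0] X[of i1 j1] z z0 z1 by blast+
  obtain A where A: "\<And>i j. i < m + n \<Longrightarrow> j < m + n \<Longrightarrow> A i j \<noteq> 0 \<longleftrightarrow> G i j"
    and SSVP: "SSVP (mat (m + n) (m + n) (\<lambda>(i, j). A i j))"
    and mult: "has_multiple_singular_value (mat (m + n) (m + n) (\<lambda>(i, j). A i j))"
    using ex_SSVP_multiple_singular_value[OF G_B X0 X1 ne] by blast
  have "has_pattern (mat (m + n) (m + n) (\<lambda>(i, j). A i j)) ?M"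
    unfolding has_pattern_def carrier_matD[OF M]
  proof (intro conjI allI impI)
    fix i j assume ij: "i < m + n" "j < m + n"
    then have "mat (m + n) (m + n) (\<lambda>(i, j). A i j) $$ (i, j) = A i j" by simp
    then show "mat (m + n) (m + n) (\<lambda>(i, j). A i j) $$ (i, j) \<noteq> 0 \<longleftrightarrow> ?M $$ (i, j) = 1"
      using A[OF ij] by (simp only: G_def)
  qed simp_all
  with SSVP mult show ?thesis by blast
qed

end
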